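(* Let $0<\alpha<\tfrac12$, let $L:\mathbb R\to(0,\infty)$ be slowly varying, and let $\mu$ be a probability measure on $\mathbb N$ with $\mu(\{n,n+1,\ldots\})\sim n^{-\alpha}L(n)$ as $n\to\infty$ and $\gcd\{n\in\mathbb N:\mu(\{n\})>0\}=1$. Assume that the renewal weights $q_n$ of $\mu$ satisfy $$q_n\sim\frac{1}{\Gamma(\alpha)\Gamma(1-\alpha)}\,\frac{n^{\alpha-1}}{L(n)}\quad\text{as }n\to\infty.$$ For $n\in\mathbb N$ let $\mathscr I^{(n)},\mathscr J^{(n)},\mathscr K^{(n)},\mathscr L^{(n)}$ be independent and uniformly distributed on $[n]$, and independent of the random graph $\mathcal G_\mu$. Then for all $\delta>0$, as $n\to\infty$, $$\mathbf P\left(\mathscr I^{(n)}\sim\mathscr J^{(n)}\sim\mathscr K^{(n)}\right)=O\left(n^{4\alpha-2+\delta}\right),$$ $$\mathbf P\left(\mathscr I^{(n)}\sim\mathscr J^{(n)}\sim\mathscr K^{(n)}\sim\mathscr L^{(n)}\right)=O\left(n^{6\alpha-3+\delta}\right).$$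
   Context: Here $\mathbb N=\{1,2,\ldots\}$ and $[n]=\{1,\ldots,n\}$. Between two real sequences, $f(n)\sim g(n)$ means $f(n)/g(n)\to1$; between (random) integers, $\sim$ denotes the random equivalence relation defined next. Let $(R_i)_{i\in\mathbb Z}$ be i.i.d. with distribution $\mu$. $\mathcal G_\mu$ is the random directed graph with vertex set $\mathbb Z$ and edge set $\{(i,i-R_i):i\in\mathbb Z\}$. For $i,j\in\mathbb Z$, $i\sim j$ means that $i$ and $j$ belong to the same connected component of $\mathcal G_\mu$ (edge directions ignored). Renewal weights: $q_n:=\mathbf P(\tilde R_1+\cdots+\tilde R_j=n\text{ for some }j\ge0)$, with $\tilde R_1,\tilde R_2,\ldots$ independent with distribution $\mu$. *)

theory Defs
  imports
    "Graph_Theory.Digraph_Component"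
    "HOL-Probability.Probability"
    "HOL-Library.Landau_Symbols"
begin

text \<open>
  Measurability of \<open>L\<close> is not part of this definition; positivity of \<open>L\<close> is stated
  separately where it is needed.
\<close>

definition slowly_varying :: "(real \<Rightarrow> real) \<Rightarrow> bool" where
  "slowly_varying L \<longleftrightarrow> (\<forall>c>0. ((\<lambda>x. L (c * x) / L x) \<longlongrightarrow> 1) at_top)"

text \<open>
  The probability is taken on the canonical space of i.i.d. sequences with law \<open>\<mu>\<close>.  The empty
  sum (\<open>j = 0\<close>) is included, so the weight at \<open>0\<close> is \<open>1\<close>.
\<close>

definition renewal_weight :: "nat pmf \<Rightarrow> nat \<Rightarrow> real" where
  "renewal_weight \<mu> n =
     measure (\<Pi>\<^sub>M k\<in>(UNIV :: nat set). measure_pmf \<mu>)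
       {r \<in> space (\<Pi>\<^sub>M k\<in>(UNIV :: nat set). measure_pmf \<mu>). \<exists>j. (\<Sum>k<j. r k) = n}"

definition jump_graph :: "(int \<Rightarrow> nat) \<Rightarrow> int pair_pre_digraph" where
  "jump_graph r = \<lparr>pverts = UNIV, parcs = {(i, i - int (r i)) | i. True}\<rparr>"

text \<open>
  Two vertices lie in the same component, edge directions ignored, if one is reachable from the
  other in the underlying symmetric graph.
\<close>

definition same_component :: "(int \<Rightarrow> nat) \<Rightarrow> int \<Rightarrow> int \<Rightarrow> bool" where
  "same_component r i j \<longleftrightarrow> i \<rightarrow>\<^sup>*\<^bsub>with_proj (mk_symmetric (with_proj (jump_graph r)))\<^esub> j"

lemma same_component_iff_rtrancl:
  "same_component r i j \<longleftrightarrow>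
     (i, j) \<in> ({(k, k - int (r k)) | k. True} \<union> {(k - int (r k), k) | k. True})\<^sup>*"
proof -
  have univ: "rtrancl_on UNIV A = A\<^sup>*" for A :: "(int \<times> int) set"
    by (auto intro: rtrancl_on_rtranclI rtrancl_consistent_rtrancl_on[where F = UNIV])
  have "parcs (mk_symmetric (with_proj (jump_graph r)))
      = {(k, k - int (r k)) | k. True} \<union> {(k - int (r k), k) | k. True}"
    by (auto simp: mk_symmetric_def jump_graph_def)
  moreover have "pverts (mk_symmetric (with_proj (jump_graph r))) = UNIV"
    by (auto simp: mk_symmetric_def jump_graph_def)
  ultimately show ?thesis
    unfolding same_component_def reachable_def by (simp add: univ)
qed

end

theory Submission
  imports Defs
begin

text \<open>
  Write \<open>u = 1 - 2 * \<alpha>\<close>.  The two bounds say that each further sampled vertex costs a factor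
  \<open>n powr (- u)\<close>, up to \<open>n powr \<delta>\<close>: three vertices lie in one component with probability of order at most
  \<open>n powr (- 2 * u)\<close>, four with probability of order at most \<open>n powr (- 3 * u)\<close>.

  Every vertex \<open>i\<close> has exactly one outgoing edge, to \<open>i - R\<^sub>i\<close>, so vertices are in the same component
  if and only if their forward paths meet.  Reveal the jumps from the top downwards: always move the
  path whose current position is the largest.  The jump used is then independent of everything
  revealed later, and as long as the paths are at distinct positions they behave like independent
  renewal processes.  Hence a sum over the possible genealogies bounds the probability that all
  paths coalesce.  For two
  paths started at \<open>a\<close> and \<open>b\<close> the bound is \<open>\<Sum>k. q (a - k) * q (b - k)\<close>, with \<open>k\<close> the meeting point and
  \<open>q\<close> the renewal weights; for three and four paths one sums over the pair that merges first and
  over the place \<open>k\<close> where it merges, and continues with one path fewer, started from \<open>k\<close>.  These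
  sums are superharmonic in the topmost starting point, by the renewal inequality, and at
  coinciding starting points they dominate the sum with one path fewer; this is all that an
  induction needs (\<open>prob_coalescence_pair\<close>, \<open>prob_coalescence_triple\<close>,
  \<open>prob_coalescence_quadruple\<close>).  Meeting points are restricted to a finite window, which keeps all
  sums finite; the window is enlarged at the very end, with bounds that do not depend on it.

  It remains to average these sums over the starting points.  The hypotheses give
  \<open>q n \<le> C * (1 + n) powr (- \<beta>)\<close> for every positive \<open>\<beta> < 1 - \<alpha>\<close> (\<open>renewal_weight_le_powr\<close>), and \<open>\<beta>\<close> can be taken
  larger than \<open>1 / 2\<close> because \<open>\<alpha> < 1 / 2\<close>.  Then \<open>\<Sum>k. q (a - k) * q (b - k)\<close> converges and is of order
  at most \<open>(1 + \<bar>a - b\<bar>) powr (- (2 * \<beta> - 1))\<close>.  Summed over \<open>b\<close> in a set of \<open>n\<close> integers this is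
  at most a constant times \<open>B = n powr (1 - (2 * \<beta> - 1))\<close>, whatever \<open>a\<close> is.  Each additional path
  contributes one more factor of this kind, so that the sums over triples and quadruples are
  \<open>O(n * B\<^sup>2)\<close> and \<open>O(n * B ^ 3)\<close>.  The one genealogy that is not a plain iteration is the one where two
  paths merge first and then meet a path that comes from a given point; it is handled by an
  elementary inequality for products of powers of distances (\<open>decay_mult_decay_le\<close>).  Dividing by
  \<open>n ^ 3\<close> and \<open>n ^ 4\<close> gives \<open>n powr (- 2 * (2 * \<beta> - 1))\<close> and \<open>n powr (- 3 * (2 * \<beta> - 1))\<close>, and letting
  \<open>\<beta>\<close> approach \<open>1 - \<alpha>\<close> gives the theorem.
\<close>

section \<open>Coalescence of forward paths\<close>

definition jump :: "(int \<Rightarrow> nat) \<Rightarrow> int \<Rightarrow> int" where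
  "jump r i = i - int (r i)"

text \<open>
  The meeting point is required to be at least \<open>lo\<close>, so that the event depends on finitely many
  jumps only.
\<close>

definition coalesce :: "(int \<Rightarrow> nat) \<Rightarrow> int \<Rightarrow> int set \<Rightarrow> bool" where
  "coalesce r lo S \<longleftrightarrow> (\<exists>x\<ge>lo. \<forall>s\<in>S. \<exists>m. (jump r ^^ m) s = x)"

lemma jump_funpow_le: "(jump r ^^ m) i \<le> i"
  by (induction m) (auto simp: jump_def intro: order_trans[rotated])

lemma coalesce_imp_ge:
  assumes "coalesce r lo S" "s \<in> S"
  shows "lo \<le> s"
  using assms jump_funpow_le unfolding coalesce_def by (metis order_trans)

lemma coalesce_antimono: "coalesce r lo S \<Longrightarrow> lo' \<le> lo \<Longrightarrow> coalesce r lo' S"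
  unfolding coalesce_def by (blast intro: order_trans)

text \<open>
  A path that ends at or above \<open>lo\<close> and starts below \<open>hi\<close> only uses jumps out of \<open>{lo..<hi}\<close>.
\<close>

lemma coalesce_local:
  assumes agree: "\<And>i. lo \<le> i \<Longrightarrow> i < hi \<Longrightarrow> r i = r' i" and S: "\<And>s. s \<in> S \<Longrightarrow> s < hi"
  shows "coalesce r lo S \<longleftrightarrow> coalesce r' lo S"
proof -
  have path: "(jump r' ^^ m) s = (jump r ^^ m) s"
    if "\<And>i. lo \<le> i \<Longrightarrow> i < hi \<Longrightarrow> r i = r' i" "s < hi" "lo \<le> (jump r ^^ m) s" for r r' m s
    using that(3)
  proof (induction m)
    case (Suc m)
    let ?i = "(jump r ^^ m) s"
    have "jump r ?i \<le> ?i" by (simp add: jump_def)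
    then have "lo \<le> ?i" "?i < hi"
      using Suc.prems jump_funpow_le[of m r s] that(2) by auto
    then have "jump r' ?i = jump r ?i"
      using that(1)[of ?i] by (simp add: jump_def)
    with \<open>lo \<le> ?i\<close> show ?case
      using Suc.IH by simp
  qed simp
  show ?thesis
    unfolding coalesce_def using path[of r r'] path[of r' r] agree S by metis
qed

text \<open>
  One step of the exploration from the top: the other paths start below \<open>v\<close>, hence meet below
  \<open>v\<close>, so the path from \<open>v\<close> has to use its jump.
\<close>

lemma coalesce_insert_jump:
  assumes "coalesce r lo (insert v S)" "S \<noteq> {}" "\<And>s. s \<in> S \<Longrightarrow> s < v"
  shows "coalesce r lo (insert (jump r v) S)"
proof -
  obtain x where x: "lo \<le> x" "\<And>s. s \<in> insert v S \<Longrightarrow> \<exists>m. (jump r ^^ m) s = x"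
    using assms(1) unfolding coalesce_def by blast
  obtain s where s: "s \<in> S" using assms(2) by blast
  have "x < v"
    using x(2)[of s] s assms(3)[OF s] jump_funpow_le[of _ r s] by (force intro: le_less_trans)
  obtain m where m: "(jump r ^^ m) v = x" using x(2) by blast
  with \<open>x < v\<close> obtain m' where "m = Suc m'" by (cases m) auto
  with m have "(jump r ^^ m') (jump r v) = x"
    by (simp only: funpow_Suc_right o_apply)
  with x show ?thesis unfolding coalesce_def by blast
qed

lemma same_component_sym: "same_component r i j \<Longrightarrow> same_component r j i"
proof -
  have "sym (({(k, k - int (r k)) | k. True} \<union> {(k - int (r k), k) | k. True})\<^sup>*)"
    by (rule sym_rtrancl) (auto simp: sym_def)
  then show "same_component r i j \<Longrightarrow> same_component r j i"
    unfolding same_component_iff_rtrancl by (auto dest: symD)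
qed

lemma same_component_trans: "same_component r i j \<Longrightarrow> same_component r j k \<Longrightarrow> same_component r i k"
  unfolding same_component_iff_rtrancl by (rule rtrancl_trans)

lemma same_component_refl: "same_component r i i"
  unfolding same_component_iff_rtrancl by simp

text \<open>
  Walking along an undirected path, an edge traversed forwards prolongs one of the two forward
  paths, and an edge traversed backwards prolongs the other.
\<close>

lemma same_component_imp_meet:
  assumes "same_component r i j"
  shows "\<exists>m n. (jump r ^^ m) i = (jump r ^^ n) j"
proof -
  have "(i, j) \<in> ({(k, jump r k) | k. True} \<union> {(jump r k, k) | k. True})\<^sup>*"
    using assms by (simp add: same_component_iff_rtrancl jump_def)
  then show ?thesis
  proof (induction rule: rtrancl_induct)
    case base then show ?case by (intro exI) (rule refl)
  next
    case (step y z)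
    then obtain m n where mn: "(jump r ^^ m) i = (jump r ^^ n) y" by blast
    consider "z = jump r y" | "y = jump r z" using step.hyps(2) by blast
    then show ?case
    proof cases
      case 1
      have "(jump r ^^ Suc m) i = (jump r ^^ n) z"
        using mn 1 by (simp add: funpow_swap1)
      then show ?thesis by blast
    next
      case 2
      have "(jump r ^^ m) i = (jump r ^^ Suc n) z"
        using mn 2 by (simp add: funpow_swap1)
      then show ?thesis by blast
    qed
  qed
qed

lemma same_component_imp_coalesce:
  assumes "finite S" "\<And>s. s \<in> S \<Longrightarrow> same_component r s a"
  shows "\<exists>lo. coalesce r lo S"
proof -
  have "\<exists>x. (\<exists>l. (jump r ^^ l) a = x) \<and> (\<forall>s\<in>S. \<exists>m. (jump r ^^ m) s = x)"
    using assms
  proof (induction S)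
    case empty then show ?case by blast
  next
    case (insert s S)
    then obtain l where l: "\<And>t. t \<in> S \<Longrightarrow> \<exists>m. (jump r ^^ m) t = (jump r ^^ l) a" by blast
    obtain m n where mn: "(jump r ^^ m) s = (jump r ^^ n) a"
      using same_component_imp_meet insert.prems by blast
    have "(jump r ^^ (l + m)) s = (jump r ^^ (n + l)) a"
      using mn by (simp add: funpow_add add.commute[of n l])
    moreover have "\<exists>m. (jump r ^^ m) t = (jump r ^^ (n + l)) a" if "t \<in> S" for t
      using l[OF that] by (metis funpow_add o_apply)
    ultimately show ?case by blast
  qed
  then show ?thesis unfolding coalesce_def by blast
qed

section \<open>Independence\<close>

text \<open>
  The form in which independence enters below: prescribed values on a finite index set \<open>A\<close> are
  independent of any event that is determined by the variables in a disjoint finite set \<open>B\<close>.  As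
  the values are natural numbers, every such event is measurable.
\<close>

lemma (in prob_space)
  fixes X :: "'i \<Rightarrow> 'a \<Rightarrow> nat" and x :: "'i \<Rightarrow> nat"
  assumes indep: "indep_vars (\<lambda>_. count_space UNIV) X I"
    and AB: "finite A" "finite B" "A \<inter> B = {}" "A \<subseteq> I" "B \<subseteq> I"
    and local: "\<And>y z. (\<And>b. b \<in> B \<Longrightarrow> y b = z b) \<Longrightarrow> Q y \<longleftrightarrow> Q z"
  shows sets_local_event: "{\<omega> \<in> space M. Q (\<lambda>i. X i \<omega>)} \<in> events"
    and prob_values_and_local_event: "prob {\<omega> \<in> space M. (\<forall>a\<in>A. X a \<omega> = x a) \<and> Q (\<lambda>i. X i \<omega>)}
      = (\<Prod>a\<in>A. prob {\<omega> \<in> space M. X a \<omega> = x a}) * prob {\<omega> \<in> space M. Q (\<lambda>i. X i \<omega>)}"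
proof -
  let ?N = "\<lambda>_::'i. count_space (UNIV :: nat set)"
  let ?F = "\<lambda>J \<omega>. restrict (\<lambda>i. X i \<omega>) J"
  let ?XA = "{restrict x A}" and ?XB = "{y \<in> B \<rightarrow>\<^sub>E UNIV. Q y}"
  have all_sets: "sets (PiM J ?N) = Pow (J \<rightarrow>\<^sub>E UNIV)" if "finite J" for J
    using count_space_PiM_finite[OF that, of "\<lambda>_. UNIV :: nat set"] by simp
  have indep2: "indep_var (PiM A ?N) (?F A) (PiM B ?N) (?F B)"
    by (rule indep_var_restrict[OF indep AB(3-5)])
  have XA: "?XA \<in> sets (PiM A ?N)" and XB: "?XB \<in> sets (PiM B ?N)"
    using all_sets[OF AB(1)] all_sets[OF AB(2)] by auto
  have eqB: "?F B -` ?XB \<inter> space M = {\<omega> \<in> space M. Q (\<lambda>i. X i \<omega>)}"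
    using local[of "?F B _"] by auto
  have agree: "?F A \<omega> = restrict x A \<longleftrightarrow> (\<forall>a\<in>A. X a \<omega> = x a)" for \<omega>
    by (auto simp: restrict_def fun_eq_iff)
  then have eqA: "?F A -` ?XA \<inter> space M = {\<omega> \<in> space M. \<forall>a\<in>A. X a \<omega> = x a}"
    by auto
  have eqAB: "(\<lambda>\<omega>. (?F A \<omega>, ?F B \<omega>)) -` (?XA \<times> ?XB) \<inter> space M
      = {\<omega> \<in> space M. (\<forall>a\<in>A. X a \<omega> = x a) \<and> Q (\<lambda>i. X i \<omega>)}"
    using eqA eqB by blast
  show "{\<omega> \<in> space M. Q (\<lambda>i. X i \<omega>)} \<in> events"
    using measurable_sets[OF indep_var_rv2[OF indep2] XB] unfolding eqB .
  have "prob {\<omega> \<in> space M. \<forall>a\<in>A. X a \<omega> = x a} = (\<Prod>a\<in>A. prob {\<omega> \<in> space M. X a \<omega> = x a})"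
  proof (cases "A = {}")
    case True then show ?thesis by (simp add: prob_space)
  next
    case False
    have eq: "{\<omega> \<in> space M. \<forall>a\<in>A. X a \<omega> = x a} = (\<Inter>a\<in>A. X a -` {x a} \<inter> space M)"
      using False by auto
    have "prob \<dots> = (\<Prod>a\<in>A. prob (X a -` {x a} \<inter> space M))"
      by (rule indep_varsD_finite[OF indep_vars_subset[OF indep AB(4)] False AB(1)]) simp
    also have "\<dots> = (\<Prod>a\<in>A. prob {\<omega> \<in> space M. X a \<omega> = x a})"
      by (intro prod.cong arg_cong[where f = prob]) auto
    finally show ?thesis using eq by simp
  qed
  then show "prob {\<omega> \<in> space M. (\<forall>a\<in>A. X a \<omega> = x a) \<and> Q (\<lambda>i. X i \<omega>)}
      = (\<Prod>a\<in>A. prob {\<omega> \<in> space M. X a \<omega> = x a}) * prob {\<omega> \<in> space M. Q (\<lambda>i. X i \<omega>)}"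
    using indep_varD[OF indep2 XA XB] unfolding eqA eqB eqAB by simp
qed

lemma (in prob_space) indep_vars_reindex:
  assumes f: "inj_on f I" and indep: "indep_vars M' X (f ` I)"
  shows "indep_vars (\<lambda>i. M' (f i)) (\<lambda>i. X (f i)) I"
  unfolding indep_vars_def2
proof (intro conjI ballI)
  fix i assume "i \<in> I"
  then show "random_variable (M' (f i)) (X (f i))"
    using indep unfolding indep_vars_def2 by blast
next
  let ?F = "\<lambda>i. {X i -` A \<inter> space M |A. A \<in> sets (M' i)}"
  have F: "indep_sets ?F (f ` I)" using indep unfolding indep_vars_def2 by blast
  show "indep_sets (\<lambda>i. ?F (f i)) I"
  proof (rule indep_setsI)
    fix i assume "i \<in> I"
    then show "?F (f i) \<subseteq> events" using F unfolding indep_sets_def by blast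
  next
    fix A J assume J: "J \<noteq> {}" "J \<subseteq> I" "finite J" "\<forall>j\<in>J. A j \<in> ?F (f j)"
    define A' where "A' = A \<circ> the_inv_into I f"
    have A': "A' (f j) = A j" if "j \<in> J" for j
      using that J(2) f by (auto simp: A'_def the_inv_into_f_f)
    have "prob (\<Inter>j\<in>f ` J. A' j) = (\<Prod>j\<in>f ` J. prob (A' j))"
      using J A' by (intro indep_setsD[OF F]) auto
    then show "prob (\<Inter>j\<in>J. A j) = (\<Prod>j\<in>J. prob (A j))"
      using A' inj_on_subset[OF f J(2)] by (simp add: prod.reindex)
  qed
qed

section \<open>Renewal weights\<close>

lemma renewal_weight_nonneg: "0 \<le> renewal_weight \<mu> n"
  by (simp add: renewal_weight_def)

lemma renewal_weight_0: "renewal_weight \<mu> 0 = 1"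
proof -
  interpret S: sequence_space "measure_pmf \<mu>" ..
  have "\<exists>j. (\<Sum>k<j. r k) = 0" for r :: "nat \<Rightarrow> nat"
    by (rule exI[of _ 0]) simp
  then show ?thesis
    by (simp add: renewal_weight_def S.P.prob_space)
qed

text \<open>
  Decomposition according to the first step, which is independent of the remaining walk.  Steps of
  size \<open>0\<close> are left out on the left-hand side, whence the inequality.
\<close>

lemma renewal_weight_first_step:
  assumes "0 < m"
  shows "(\<Sum>r\<in>{1..m}. pmf \<mu> r * renewal_weight \<mu> (m - r)) \<le> renewal_weight \<mu> m"
proof -
  interpret S: sequence_space "measure_pmf \<mu>" ..
  let ?S = "\<Pi>\<^sub>M k\<in>(UNIV :: nat set). measure_pmf \<mu>"
  define Hit where "Hit n = {r \<in> space ?S. \<exists>j. (\<Sum>k<j. r k) = n}" for n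
  have Hit_sets [measurable]: "Hit n \<in> sets ?S" for n
    unfolding Hit_def by measurable
  \<comment> \<open>Prepending a step to an independent sequence gives a sequence with the same law.\<close>
  let ?step = "\<lambda>(s, \<omega>). case_nat s \<omega> :: nat \<Rightarrow> nat"
  let ?P = "measure_pmf \<mu> \<Otimes>\<^sub>M ?S"
  interpret P: pair_prob_space "measure_pmf \<mu>" ?S ..
  have step: "?step \<in> ?P \<rightarrow>\<^sub>M ?S"
    by measurable
  have sub: "(\<Union>r\<in>{1..m}. {r} \<times> Hit (m - r)) \<subseteq> ?step -` Hit m \<inter> space ?P"
  proof (clarsimp simp: Hit_def space_pair_measure space_PiM)
    fix r j and \<omega> :: "nat \<Rightarrow> nat" assume "Suc 0 \<le> r" "r \<le> m" "sum \<omega> {..<j} = m - r"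
    then have "(\<Sum>k<Suc j. case_nat r \<omega> k) = m"
      by (simp add: sum.lessThan_Suc_shift del: sum.lessThan_Suc)
    then show "\<exists>j. (\<Sum>k<j. case_nat r \<omega> k) = m" by blast
  qed
  have "(\<Sum>r\<in>{1..m}. pmf \<mu> r * renewal_weight \<mu> (m - r)) = (\<Sum>r\<in>{1..m}. measure ?P ({r} \<times> Hit (m - r)))"
    by (intro sum.cong refl) (simp add: measure_def S.P.emeasure_pair_measure_Times enn2real_mult
        renewal_weight_def Hit_def[symmetric] pmf.rep_eq)
  also have "\<dots> = measure ?P (\<Union>r\<in>{1..m}. {r} \<times> Hit (m - r))"
    by (rule P.P.finite_measure_finite_Union[symmetric]) (auto simp: disjoint_family_on_def)
  also have "\<dots> \<le> measure ?P (?step -` Hit m \<inter> space ?P)"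
    by (rule P.P.finite_measure_mono[OF sub]) (rule measurable_sets[OF step Hit_sets])
  also have "\<dots> = measure (distr ?P ?S ?step) (Hit m)"
    by (rule measure_distr[symmetric, OF step Hit_sets])
  also have "\<dots> = renewal_weight \<mu> m"
    by (simp only: S.PiM_iter renewal_weight_def Hit_def)
  finally show ?thesis .
qed

section \<open>Weights of genealogies\<close>

text \<open>
  With \<open>w\<close> the renewal weights, \<open>merge w W a b G\<close> is the total weight of the ways in which paths
  from \<open>a\<close> and \<open>b\<close> can merge at a point \<open>k\<close> of the window \<open>W\<close>, when \<open>G k\<close> is the weight of what happens
  after the merger.
\<close>

definition merge :: "(int \<Rightarrow> real) \<Rightarrow> int set \<Rightarrow> int \<Rightarrow> int \<Rightarrow> (int \<Rightarrow> real) \<Rightarrow> real" where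
  "merge w W a b G = (\<Sum>k\<in>W. w (a - k) * w (b - k) * G k)"

text \<open>
  The weights of the genealogies of two, three and four paths.  A genealogy of \<open>m\<close> paths is a
  choice of the two paths that merge first, followed by a genealogy of \<open>m - 1\<close> paths.  The
  order of mergers in disjoint branches is recorded, so some genealogies are counted more than
  once, which is harmless for an upper bound.
\<close>

definition pair_weight :: "(int \<Rightarrow> real) \<Rightarrow> int set \<Rightarrow> int \<Rightarrow> int \<Rightarrow> real" where
  "pair_weight w W a b = merge w W a b (\<lambda>_. 1)"

definition triple_weight :: "(int \<Rightarrow> real) \<Rightarrow> int set \<Rightarrow> int \<Rightarrow> int \<Rightarrow> int \<Rightarrow> real" where
  "triple_weight w W a b c =
     merge w W a b (\<lambda>k. pair_weight w W k c) +
     merge w W a c (\<lambda>k. pair_weight w W k b) +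
     merge w W b c (\<lambda>k. pair_weight w W k a)"

definition quadruple_weight :: "(int \<Rightarrow> real) \<Rightarrow> int set \<Rightarrow> int \<Rightarrow> int \<Rightarrow> int \<Rightarrow> int \<Rightarrow> real" where
  "quadruple_weight w W a b c d =
     merge w W a b (\<lambda>k. triple_weight w W k c d) +
     merge w W a c (\<lambda>k. triple_weight w W k b d) +
     merge w W a d (\<lambda>k. triple_weight w W k b c) +
     merge w W b c (\<lambda>k. triple_weight w W k a d) +
     merge w W b d (\<lambda>k. triple_weight w W k a c) +
     merge w W c d (\<lambda>k. triple_weight w W k a b)"

lemma merge_commute: "merge w W a b G = merge w W b a G"
  by (simp add: merge_def mult.commute)

lemma pair_weight_commute: "pair_weight w W a b = pair_weight w W b a"
  by (simp add: pair_weight_def merge_commute)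

lemma triple_weight_swap:
  "triple_weight w W a b c = triple_weight w W b a c"
  "triple_weight w W a b c = triple_weight w W a c b"
  by (simp_all add: triple_weight_def merge_commute[of w W b a] merge_commute[of w W c b])

lemma quadruple_weight_swap:
  "quadruple_weight w W a b c d = quadruple_weight w W b a c d"
  "quadruple_weight w W a b c d = quadruple_weight w W a c b d"
  "quadruple_weight w W a b c d = quadruple_weight w W a b d c"
  by (simp_all add: quadruple_weight_def merge_commute[of w W b a] merge_commute[of w W c b] merge_commute[of w W d c]
     triple_weight_swap(2))

text \<open>
  The last assumption says that \<open>w\<close> is superharmonic off \<open>0\<close> for a walk that jumps downwards by \<open>r\<close>
  with weight \<open>p r\<close>, and the second that the walk cannot hit points above its current position.
\<close>

locale superharmonic_kernel =
  fixes w :: "int \<Rightarrow> real" and W :: "int set" and p :: "nat \<Rightarrow> real" and J :: "nat set"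
  assumes w_nonneg: "0 \<le> w d"
    and w_neg: "d < 0 \<Longrightarrow> w d = 0"
    and w_0: "w 0 = 1"
    and finite_W: "finite W"
    and w_step: "0 < d \<Longrightarrow> (\<Sum>r\<in>J. p r * w (d - int r)) \<le> w d"
begin

lemma merge_nonneg: "(\<And>k. 0 \<le> G k) \<Longrightarrow> 0 \<le> merge w W a b G"
  by (auto simp: merge_def intro!: sum_nonneg mult_nonneg_nonneg w_nonneg)

lemma pair_weight_nonneg: "0 \<le> pair_weight w W a b"
  by (simp add: pair_weight_def merge_nonneg)

lemma triple_weight_nonneg: "0 \<le> triple_weight w W a b c"
  by (simp add: triple_weight_def merge_nonneg pair_weight_nonneg)

lemma quadruple_weight_nonneg: "0 \<le> quadruple_weight w W a b c d"
  by (simp add: quadruple_weight_def merge_nonneg triple_weight_nonneg)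

text \<open>
  Two paths that start at the same point may be taken to have merged there.
\<close>

lemma merge_diagonal:
  assumes "a \<in> W" "\<And>k. 0 \<le> G k"
  shows "G a \<le> merge w W a a G"
proof -
  have "w (a - a) * w (a - a) * G a \<le> merge w W a a G"
    unfolding merge_def using assms
    by (intro member_le_sum) (auto simp: finite_W w_nonneg)
  then show ?thesis by (simp add: w_0)
qed

text \<open>
  Only mergers at \<open>k \<le> b < a\<close> carry weight, and for these the path from \<open>a\<close> has not yet arrived.
\<close>

lemma merge_superharmonic:
  assumes "b < a" "\<And>k. 0 \<le> G k"
  shows "(\<Sum>r\<in>J. p r * merge w W (a - int r) b G) \<le> merge w W a b G"
proof -
  have "(\<Sum>r\<in>J. p r * merge w W (a - int r) b G)
      = (\<Sum>k\<in>W. (\<Sum>r\<in>J. p r * w (a - k - int r)) * (w (b - k) * G k))"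
    unfolding merge_def sum_distrib_left sum_distrib_right
    by (subst sum.swap) (simp add: algebra_simps)
  also have "\<dots> \<le> (\<Sum>k\<in>W. w (a - k) * (w (b - k) * G k))"
  proof (intro sum_mono)
    fix k
    show "(\<Sum>r\<in>J. p r * w (a - k - int r)) * (w (b - k) * G k) \<le> w (a - k) * (w (b - k) * G k)"
    proof (cases "k \<le> b")
      case True
      then show ?thesis
        using assms w_nonneg by (intro mult_right_mono w_step mult_nonneg_nonneg) auto
    qed (simp add: w_neg)
  qed
  finally show ?thesis by (simp add: merge_def mult.assoc)
qed

text \<open>
  The same when the path from \<open>a\<close> does not take part in the first merger, which happens at or
  below \<open>b\<close>.
\<close>

lemma merge_superharmonic_inner:
  assumes "\<And>k. k \<le> b \<Longrightarrow> (\<Sum>r\<in>J. p r * G (a - int r) k) \<le> G a k"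
  shows "(\<Sum>r\<in>J. p r * merge w W b c (G (a - int r))) \<le> merge w W b c (G a)"
proof -
  have "(\<Sum>r\<in>J. p r * merge w W b c (G (a - int r)))
      = (\<Sum>k\<in>W. w (b - k) * w (c - k) * (\<Sum>r\<in>J. p r * G (a - int r) k))"
    unfolding merge_def sum_distrib_left
    by (subst sum.swap) (simp add: algebra_simps)
  also have "\<dots> \<le> (\<Sum>k\<in>W. w (b - k) * w (c - k) * G a k)"
  proof (intro sum_mono)
    fix k
    show "w (b - k) * w (c - k) * (\<Sum>r\<in>J. p r * G (a - int r) k) \<le> w (b - k) * w (c - k) * G a k"
    proof (cases "k \<le> b")
      case True
      then show ?thesis
        using assms w_nonneg by (intro mult_left_mono mult_nonneg_nonneg) auto
    qed (simp add: w_neg)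
  qed
  finally show ?thesis by (simp add: merge_def)
qed

lemma pair_weight_superharmonic:
  "b < a \<Longrightarrow> (\<Sum>r\<in>J. p r * pair_weight w W (a - int r) b) \<le> pair_weight w W a b"
  unfolding pair_weight_def by (rule merge_superharmonic) auto

lemma triple_weight_superharmonic:
  assumes "b < a" "c < a"
  shows "(\<Sum>r\<in>J. p r * triple_weight w W (a - int r) b c) \<le> triple_weight w W a b c"
  unfolding triple_weight_def distrib_left sum.distrib
  using assms pair_weight_superharmonic
  by (intro add_mono merge_superharmonic pair_weight_nonneg
      merge_superharmonic_inner[where G = "\<lambda>a k. pair_weight w W k a"])
    (auto simp: pair_weight_commute[of w W _ "a - _"] pair_weight_commute[of w W _ a])

lemma quadruple_weight_superharmonic:
  assumes "b < a" "c < a" "d < a"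
  shows "(\<Sum>r\<in>J. p r * quadruple_weight w W (a - int r) b c d) \<le> quadruple_weight w W a b c d"
proof -
  have *: "(\<Sum>r\<in>J. p r * merge w W x y (\<lambda>k. triple_weight w W k (a - int r) z))
      \<le> merge w W x y (\<lambda>k. triple_weight w W k a z)" if "x < a" "z < a" for x y z
    using that triple_weight_superharmonic[of _ a z]
    by (intro merge_superharmonic_inner[where G = "\<lambda>a k. triple_weight w W k a z"])
      (simp add: triple_weight_swap(1)[of w W _ "a - _"] triple_weight_swap(1)[of w W _ a])
  show ?thesis
    unfolding quadruple_weight_def distrib_left sum.distrib
    using assms by (intro add_mono merge_superharmonic triple_weight_nonneg *) auto
qed

end

section \<open>Coalescence probabilities\<close>

definition hitting_weight :: "nat pmf \<Rightarrow> int \<Rightarrow> real" where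
  "hitting_weight \<mu> d = (if d < 0 then 0 else renewal_weight \<mu> (nat d))"

lemma hitting_weight_nonneg: "0 \<le> hitting_weight \<mu> d"
  by (simp add: hitting_weight_def renewal_weight_nonneg)

text \<open>
  The truncation of the jumps to \<open>{1..n}\<close> only discards nonnegative terms.
\<close>

lemma superharmonic_hitting_weight:
  "superharmonic_kernel (hitting_weight \<mu>) {lo..hi} (pmf \<mu>) {1..n}"
proof
  fix d :: int assume d: "0 < d"
  have "(\<Sum>r\<in>{1..n}. pmf \<mu> r * hitting_weight \<mu> (d - int r))
      = (\<Sum>r\<in>{1..n} \<inter> {1..nat d}. pmf \<mu> r * hitting_weight \<mu> (d - int r))"
    by (rule sum.mono_neutral_right) (auto simp: hitting_weight_def)
  also have "\<dots> \<le> (\<Sum>r\<in>{1..nat d}. pmf \<mu> r * hitting_weight \<mu> (d - int r))"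
    by (rule sum_mono2) (auto simp: hitting_weight_def renewal_weight_nonneg)
  also have "\<dots> = (\<Sum>r\<in>{1..nat d}. pmf \<mu> r * renewal_weight \<mu> (nat d - r))"
    using d by (intro sum.cong) (auto simp: hitting_weight_def nat_diff_distrib)
  also have "\<dots> \<le> hitting_weight \<mu> d"
    using renewal_weight_first_step[of "nat d" \<mu>] d by (simp add: hitting_weight_def)
  finally show "(\<Sum>r\<in>{1..n}. pmf \<mu> r * hitting_weight \<mu> (d - int r)) \<le> hitting_weight \<mu> d" .
qed (auto simp: hitting_weight_def renewal_weight_nonneg renewal_weight_0)

locale iid_jumps = prob_space M for M :: "'a measure" +
  fixes \<mu> :: "nat pmf" and R :: "int \<Rightarrow> 'a \<Rightarrow> nat"
  assumes indep: "indep_vars (\<lambda>_. count_space UNIV) R UNIV"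
    and distr: "\<And>i. distr M (count_space UNIV) (R i) = measure_pmf \<mu>"
    and zero_notin: "0 \<notin> set_pmf \<mu>"
begin

lemma R_measurable: "R i \<in> M \<rightarrow>\<^sub>M count_space UNIV"
  using indep by (auto simp: indep_vars_def)

lemma prob_R: "prob {\<omega> \<in> space M. R i \<omega> = n} = pmf \<mu> n"
proof -
  have "measure (distr M (count_space UNIV) (R i)) {n} = prob (R i -` {n} \<inter> space M)"
    by (rule measure_distr[OF R_measurable]) simp
  also have "R i -` {n} \<inter> space M = {\<omega> \<in> space M. R i \<omega> = n}" by auto
  finally show ?thesis by (simp add: distr pmf.rep_eq)
qed

lemma AE_R_pos: "AE \<omega> in M. \<forall>i. 0 < R i \<omega>"
proof -
  have "AE \<omega> in M. 0 < R i \<omega>" for i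
  proof -
    have "AE n in distr M (count_space UNIV) (R i). 0 < n"
      unfolding distr using zero_notin by (auto simp: AE_measure_pmf_iff intro: gr0I)
    then show ?thesis by (rule AE_distrD[OF R_measurable])
  qed
  then show ?thesis by (simp add: AE_all_countable)
qed

definition coalescence :: "int \<Rightarrow> int set \<Rightarrow> 'a set" where
  "coalescence lo S = {\<omega> \<in> space M. coalesce (\<lambda>i. R i \<omega>) lo S}"

lemma coalescence_sets:
  assumes "finite S" shows "coalescence lo S \<in> events"
proof -
  have "s < Max (insert 0 S) + 1" if "s \<in> S" for s
    using that assms by (simp add: less_add_one[THEN le_less_trans[rotated]] zle_add1_eq_le)
  then show ?thesis
    unfolding coalescence_def
    by (intro sets_local_event[OF indep, of "{}" "{lo..<Max (insert 0 S) + 1}"] coalesce_local[of lo "Max (insert 0 S) + 1"]) auto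
qed

text \<open>
  Conditioning on the jump at the topmost vertex \<open>v\<close>.  After this jump all paths start below \<open>v\<close>, so
  the rest of the event does not involve the jump at \<open>v\<close>.  A jump by more than \<open>hi - lo\<close> leads
  below \<open>lo\<close>, where coalescence at or above \<open>lo\<close> is impossible.
\<close>

lemma coalescence_step:
  assumes S: "finite S" "S \<noteq> {}" "\<And>s. s \<in> S \<Longrightarrow> s < v" and "v \<le> hi"
  shows "prob (coalescence lo (insert v S))
    \<le> (\<Sum>r\<in>{1..nat (hi - lo)}. pmf \<mu> r * prob (coalescence lo (insert (v - int r) S)))"
proof -
  let ?E = "\<lambda>r. {\<omega> \<in> space M. (\<forall>a\<in>{v}. R a \<omega> = r) \<and> coalesce (\<lambda>i. R i \<omega>) lo (insert (v - int r) S)}"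
  have E: "?E r = {\<omega> \<in> space M. R v \<omega> = r} \<inter> coalescence lo (insert (v - int r) S)" for r
    by (auto simp: coalescence_def)
  have E_sets: "?E r \<in> events" for r
  proof -
    have "{\<omega> \<in> space M. R v \<omega> = r} = R v -` {r} \<inter> space M" by auto
    also have "\<dots> \<in> events" by (rule measurable_sets[OF R_measurable]) simp
    finally show ?thesis unfolding E using S(1) by (intro sets.Int coalescence_sets) auto
  qed
  have "AE \<omega> in M. \<omega> \<in> coalescence lo (insert v S) \<longrightarrow> \<omega> \<in> (\<Union>r\<in>{1..nat (hi - lo)}. ?E r)"
    using AE_R_pos
  proof eventually_elim
    case (elim \<omega>)
    show ?case
    proof
      assume \<omega>: "\<omega> \<in> coalescence lo (insert v S)"
      then have c: "coalesce (\<lambda>i. R i \<omega>) lo (insert (jump (\<lambda>i. R i \<omega>) v) S)"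
        unfolding coalescence_def using S(2,3) by (intro coalesce_insert_jump) auto
      then have "lo \<le> v - int (R v \<omega>)"
        using coalesce_imp_ge[OF c, of "jump (\<lambda>i. R i \<omega>) v"] by (simp add: jump_def)
      then have "R v \<omega> \<in> {1..nat (hi - lo)}"
        using elim[THEN spec, of v] \<open>v \<le> hi\<close> by auto
      moreover have "\<omega> \<in> ?E (R v \<omega>)"
        using c \<omega> by (simp add: jump_def coalescence_def)
      ultimately show "\<omega> \<in> (\<Union>r\<in>{1..nat (hi - lo)}. ?E r)" by blast
    qed
  qed
  then have "prob (coalescence lo (insert v S)) \<le> prob (\<Union>r\<in>{1..nat (hi - lo)}. ?E r)"
    using E_sets by (intro finite_measure_mono_AE sets.finite_UN) auto
  also have "\<dots> \<le> (\<Sum>r\<in>{1..nat (hi - lo)}. prob (?E r))"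
    using E_sets by (intro finite_measure_subadditive_finite) auto
  also have "\<dots> = (\<Sum>r\<in>{1..nat (hi - lo)}. pmf \<mu> r * prob (coalescence lo (insert (v - int r) S)))"
  proof (rule sum.cong[OF refl])
    fix r assume r: "r \<in> {1..nat (hi - lo)}"
    have "prob (?E r) = (\<Prod>a\<in>{v}. prob {\<omega> \<in> space M. R a \<omega> = r})
        * prob {\<omega> \<in> space M. coalesce (\<lambda>i. R i \<omega>) lo (insert (v - int r) S)}"
      using r S(3)
      by (intro prob_values_and_local_event[OF indep, where B = "{lo..<v}"] coalesce_local[of lo v]) auto
    then show "prob (?E r) = pmf \<mu> r * prob (coalescence lo (insert (v - int r) S))"
      by (simp add: prob_R coalescence_def)
  qed
  finally show ?thesis .
qed

lemma prob_coalescence_below: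
  assumes "s \<in> S" "s < lo"
  shows "prob (coalescence lo S) = 0"
proof -
  have "coalescence lo S = {}"
    using assms coalesce_imp_ge unfolding coalescence_def by (metis (no_types, lifting) empty_Collect_eq leD)
  then show ?thesis by simp
qed

context
  fixes lo hi :: int
begin

interpretation superharmonic_kernel "hitting_weight \<mu>" "{lo..hi}" "pmf \<mu>" "{1..nat (hi - lo)}"
  by (rule superharmonic_hitting_weight)

abbreviation "pair \<equiv> pair_weight (hitting_weight \<mu>) {lo..hi}"
abbreviation "triple \<equiv> triple_weight (hitting_weight \<mu>) {lo..hi}"
abbreviation "quadruple \<equiv> quadruple_weight (hitting_weight \<mu>) {lo..hi}"

text \<open>
  The induction step shared by the bounds for two, three and four paths: \<open>\<Phi>\<close> is a genealogy
  weight as a function of its topmost starting point.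
\<close>

lemma coalescence_le_superharmonic:
  assumes S: "finite S" "S \<noteq> {}" "\<And>s. s \<in> S \<Longrightarrow> s < v" and "v \<le> hi"
    and IH: "\<And>r. 0 < r \<Longrightarrow> prob (coalescence lo (insert (v - int r) S)) \<le> \<Phi> (v - int r)"
    and \<Phi>: "(\<Sum>r\<in>{1..nat (hi - lo)}. pmf \<mu> r * \<Phi> (v - int r)) \<le> \<Phi> v"
  shows "prob (coalescence lo (insert v S)) \<le> \<Phi> v"
proof -
  have "prob (coalescence lo (insert v S))
      \<le> (\<Sum>r\<in>{1..nat (hi - lo)}. pmf \<mu> r * prob (coalescence lo (insert (v - int r) S)))"
    by (rule coalescence_step[OF S \<open>v \<le> hi\<close>])
  also have "\<dots> \<le> (\<Sum>r\<in>{1..nat (hi - lo)}. pmf \<mu> r * \<Phi> (v - int r))"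
  proof (rule sum_mono)
    fix r assume "r \<in> {1..nat (hi - lo)}"
    then show "pmf \<mu> r * prob (coalescence lo (insert (v - int r) S)) \<le> pmf \<mu> r * \<Phi> (v - int r)"
      by (intro mult_left_mono IH pmf_nonneg) simp
  qed
  also have "\<dots> \<le> \<Phi> v" by (rule \<Phi>)
  finally show ?thesis .
qed

text \<open>
  Induction on the total height above \<open>lo\<close>.  If the starting points are distinct, the topmost one
  jumps; if two of them coincide, the genealogy weight with one path fewer is a lower bound for the
  weight in question.
\<close>

lemma prob_coalescence_pair:
  assumes "a \<le> hi" "b \<le> hi"
  shows "prob (coalescence lo {a, b}) \<le> pair a b"
  using assms
proof (induction "nat (a - lo) + nat (b - lo)" arbitrary: a b rule: less_induct)
  case less
  have larger_first: "prob (coalescence lo {a, b}) \<le> pair a b"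
    if "b < a" "lo \<le> b" "a \<le> hi"
      and IH: "\<And>r. 0 < r \<Longrightarrow> prob (coalescence lo {a - int r, b}) \<le> pair (a - int r) b" for a b
    using that pair_weight_superharmonic[OF that(1)]
    by - (rule coalescence_le_superharmonic[where \<Phi> = "\<lambda>a. pair a b"], auto)
  consider "a < lo \<or> b < lo" | "a = b" "lo \<le> a" | "b < a" "lo \<le> b" | "a < b" "lo \<le> a" by linarith
  then show ?case
  proof cases
    case 1
    then have "prob (coalescence lo {a, b}) = 0"
      using prob_coalescence_below[of a "{a, b}"] prob_coalescence_below[of b "{a, b}"] by auto
    then show ?thesis using pair_weight_nonneg by simp
  next
    case 2
    then have "1 \<le> pair a b"
      using merge_diagonal[of a "\<lambda>_. 1"] less.prems by (simp add: pair_weight_def)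
    then show ?thesis using prob_le_1 order_trans by blast
  next
    case 3
    then show ?thesis using less.prems by - (rule larger_first, auto intro!: less.hyps)
  next
    case 4
    then have "prob (coalescence lo {b, a}) \<le> pair b a"
      using less.prems by - (rule larger_first, auto intro!: less.hyps)
    then show ?thesis by (simp add: insert_commute pair_weight_commute)
  qed
qed

lemma prob_coalescence_triple:
  assumes "a \<le> hi" "b \<le> hi" "c \<le> hi"
  shows "prob (coalescence lo {a, b, c}) \<le> triple a b c"
  using assms
proof (induction "nat (a - lo) + nat (b - lo) + nat (c - lo)" arbitrary: a b c rule: less_induct)
  case less
  \<comment> \<open>Both sides are symmetric in the starting points, which reduces every case to one where the
    relevant points come first.\<close>
  define claim where "claim a b c \<longleftrightarrow> prob (coalescence lo {a, b, c}) \<le> triple a b c" for a b c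
  have swap: "claim a b c \<Longrightarrow> claim b a c" "claim a b c \<Longrightarrow> claim a c b" for a b c
    using triple_weight_swap[of "hitting_weight \<mu>" "{lo..hi}" a b c]
    unfolding claim_def by (simp_all add: insert_commute)
  have equal: "claim a a c" if "lo \<le> a" "a \<le> hi" "c \<le> hi" for a c
  proof -
    have "pair a c \<le> merge (hitting_weight \<mu>) {lo..hi} a a (\<lambda>k. pair k c)"
      using that by (intro merge_diagonal pair_weight_nonneg) auto
    also have "\<dots> \<le> triple a a c"
      by (simp add: triple_weight_def merge_nonneg pair_weight_nonneg)
    finally show ?thesis using prob_coalescence_pair[of a c] that by (simp add: claim_def)
  qed
  have larger_first: "claim a b c"
    if "b < a" "c < a" "a \<le> hi" "\<And>r. 0 < r \<Longrightarrow> claim (a - int r) b c" for a b c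
    using that triple_weight_superharmonic[OF that(1,2)] unfolding claim_def
    by - (rule coalescence_le_superharmonic[where \<Phi> = "\<lambda>a. triple a b c"], auto)
  have IH: "claim a' b' c'"
    if "nat (a' - lo) + nat (b' - lo) + nat (c' - lo) < nat (a - lo) + nat (b - lo) + nat (c - lo)"
      "a' \<le> hi" "b' \<le> hi" "c' \<le> hi" for a' b' c'
    unfolding claim_def by (rule less.hyps[OF that])
  have "claim a b c"
  proof (cases "a < lo \<or> b < lo \<or> c < lo")
    case True
    then have "prob (coalescence lo {a, b, c}) = 0"
      using prob_coalescence_below[of _ "{a, b, c}"] by auto
    then show ?thesis using triple_weight_nonneg by (simp add: claim_def)
  next
    case False
    then have lo: "lo \<le> a" "lo \<le> b" "lo \<le> c" by auto
    consider "a = b" | "a = c" | "b = c" | "b < a" "c < a" | "a < b" "c < b" | "a < c" "b < c"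
      by linarith
    then show ?thesis
    proof cases
      case 1
      then show ?thesis using equal[of a c] lo less.prems by simp
    next
      case 2
      then show ?thesis using swap(2)[OF equal[of a b]] lo less.prems by simp
    next
      case 3
      then show ?thesis using swap(1)[OF swap(2)[OF equal[of b a]]] lo less.prems by simp
    next
      case 4
      then show ?thesis using less.prems lo by - (rule larger_first, auto intro!: IH)
    next
      case 5
      then have "claim b a c" using less.prems lo by - (rule larger_first, auto intro!: IH)
      then show ?thesis by (rule swap(1))
    next
      case 6
      then have "claim c a b" using less.prems lo by - (rule larger_first, auto intro!: IH)
      then show ?thesis by (rule swap(2)[OF swap(1)])
    qed
  qed
  then show ?case by (simp only: claim_def)
qed

lemma prob_coalescence_quadruple:
  assumes "a \<le> hi" "b \<le> hi" "c \<le> hi" "d \<le> hi"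
  shows "prob (coalescence lo {a, b, c, d}) \<le> quadruple a b c d"
  using assms
proof (induction "nat (a - lo) + nat (b - lo) + nat (c - lo) + nat (d - lo)" arbitrary: a b c d rule: less_induct)
  case less
  define claim where "claim a b c d \<longleftrightarrow> prob (coalescence lo {a, b, c, d}) \<le> quadruple a b c d" for a b c d
  have swap: "claim a b c d \<Longrightarrow> claim b a c d" "claim a b c d \<Longrightarrow> claim a c b d" "claim a b c d \<Longrightarrow> claim a b d c" for a b c d
    using quadruple_weight_swap[of "hitting_weight \<mu>" "{lo..hi}" a b c d]
    unfolding claim_def by (simp_all add: insert_commute)
  have equal: "claim a a c d" if "lo \<le> a" "a \<le> hi" "c \<le> hi" "d \<le> hi" for a c d
  proof -
    have "triple a c d \<le> merge (hitting_weight \<mu>) {lo..hi} a a (\<lambda>k. triple k c d)"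
      using that by (intro merge_diagonal triple_weight_nonneg) auto
    also have "\<dots> \<le> quadruple a a c d"
      by (simp add: quadruple_weight_def merge_nonneg triple_weight_nonneg)
    finally show ?thesis using prob_coalescence_triple[of a c d] that by (simp add: claim_def)
  qed
  have larger_first: "claim a b c d"
    if "b < a" "c < a" "d < a" "a \<le> hi" "\<And>r. 0 < r \<Longrightarrow> claim (a - int r) b c d" for a b c d
    using that quadruple_weight_superharmonic[OF that(1,2,3)] unfolding claim_def
    by - (rule coalescence_le_superharmonic[where \<Phi> = "\<lambda>a. quadruple a b c d"], auto)
  have IH: "claim a' b' c' d'"
    if "nat (a' - lo) + nat (b' - lo) + nat (c' - lo) + nat (d' - lo) < nat (a - lo) + nat (b - lo) + nat (c - lo) + nat (d - lo)"
      "a' \<le> hi" "b' \<le> hi" "c' \<le> hi" "d' \<le> hi" for a' b' c' d'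
    unfolding claim_def by (rule less.hyps[OF that])
  have "claim a b c d"
  proof (cases "a < lo \<or> b < lo \<or> c < lo \<or> d < lo")
    case True
    then have "prob (coalescence lo {a, b, c, d}) = 0"
      using prob_coalescence_below[of _ "{a, b, c, d}"] by auto
    then show ?thesis using quadruple_weight_nonneg by (simp add: claim_def)
  next
    case False
    then have lo: "lo \<le> a" "lo \<le> b" "lo \<le> c" "lo \<le> d" by auto
    consider "a = b" | "a = c" | "a = d" | "b = c" | "b = d" | "c = d"
      | "b < a" "c < a" "d < a" | "a < b" "c < b" "d < b" | "a < c" "b < c" "d < c" | "a < d" "b < d" "c < d"
      by linarith
    then show ?thesis
    proof cases
      case 1
      then show ?thesis using equal[of a c d] lo less.prems by simp
    next
      case 2
      then show ?thesis using swap(2)[OF equal[of a b d]] lo less.prems by simp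
    next
      case 3
      then show ?thesis using swap(3)[OF swap(2)[OF equal[of a b c]]] lo less.prems by simp
    next
      case 4
      then show ?thesis using swap(1)[OF swap(2)[OF equal[of b a d]]] lo less.prems by simp
    next
      case 5
      then show ?thesis using swap(3)[OF swap(1)[OF swap(2)[OF equal[of b a c]]]] lo less.prems by simp
    next
      case 6
      then show ?thesis
        using swap(2)[OF swap(3)[OF swap(1)[OF swap(2)[OF equal[of c a b]]]]] lo less.prems by simp
    next
      case 7
      then show ?thesis using less.prems lo by - (rule larger_first, auto intro!: IH)
    next
      case 8
      then have "claim b a c d" using less.prems lo by - (rule larger_first, auto intro!: IH)
      then show ?thesis by (rule swap(1))
    next
      case 9
      then have "claim c a b d" using less.prems lo by - (rule larger_first, auto intro!: IH)
      then show ?thesis by (rule swap(2)[OF swap(1)])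
    next
      case 10
      then have "claim d a b c" using less.prems lo by - (rule larger_first, auto intro!: IH)
      then show ?thesis by (rule swap(3)[OF swap(2)[OF swap(1)]])
    qed
  qed
  then show ?case by (simp only: claim_def)
qed

end

end

section \<open>Power sums over integer distances\<close>

text \<open>
  Mean value theorem; the point is to sum both sides over \<open>x\<close>, where the right-hand side
  telescopes.
\<close>

lemma diff_le_powr_diff:
  fixes s :: real assumes "0 < s" "s < 1" "0 < x"
  shows "(1 - s) * (x + 1) powr (- s) \<le> (x + 1) powr (1 - s) - x powr (1 - s)"
proof -
  have "\<exists>z>x. z < x + 1 \<and> (x + 1) powr (1 - s) - x powr (1 - s) = (x + 1 - x) * ((1 - s) * z powr (1 - s - 1))"
    using assms by (intro MVT2) (auto intro!: derivative_eq_intros simp: has_real_derivative_powr)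
  then obtain z where z: "x < z" "z < x + 1"
    "(x + 1) powr (1 - s) - x powr (1 - s) = (1 - s) * z powr (- s)" by auto
  have "(x + 1) powr (- s) \<le> z powr (- s)"
    using z assms by (intro powr_mono2') auto
  then show ?thesis using z(3) assms by (simp add: mult_left_mono)
qed

lemma sum_powr_le:
  fixes s :: real assumes "0 < s" "s < 1"
  shows "(\<Sum>t<n. (1 + real t) powr (- s)) \<le> real n powr (1 - s) / (1 - s)"
proof (induction n)
  case (Suc n)
  have "(1 + real n) powr (- s) \<le> (real (Suc n) powr (1 - s) - real n powr (1 - s)) / (1 - s)"
  proof (cases "n = 0")
    case True then show ?thesis using assms by (simp add: field_simps)
  next
    case False
    then show ?thesis using diff_le_powr_diff[OF assms, of "real n"] assms
      by (simp add: field_simps add.commute)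
  qed
  with Suc.IH show ?case by (simp add: diff_divide_distrib)
qed simp

lemma sum_powr_tail_le:
  fixes s :: real assumes "1 < s"
  shows "(\<Sum>t\<in>{d<..<X}. (1 + real t) powr (- s)) \<le> (1 + real d) powr (1 - s) / (s - 1)"
proof -
  have "(\<Sum>t\<in>{d<..<d + m}. (1 + real t) powr (- s)) + (real d + real m) powr (1 - s) / (s - 1)
      \<le> (1 + real d) powr (1 - s) / (s - 1)" if "1 \<le> m" for m
    using that
  proof (induction m rule: dec_induct)
    case base
    have "{d<..<d + 1} = {}" by auto
    then show ?case by (simp add: add.commute)
  next
    case (step m)
    let ?x = "real d + real m"
    have x: "0 < ?x" using step by simp
    have "\<exists>z>?x. z < ?x + 1 \<and> (?x + 1) powr (1 - s) - ?x powr (1 - s) = (?x + 1 - ?x) * ((1 - s) * z powr (1 - s - 1))"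
      using x by (intro MVT2) (auto intro!: derivative_eq_intros simp: has_real_derivative_powr)
    then obtain z where z: "?x < z" "z < ?x + 1"
      "(?x + 1) powr (1 - s) - ?x powr (1 - s) = (1 - s) * z powr (- s)" by auto
    have "(?x + 1) powr (- s) \<le> z powr (- s)"
      using z assms x by (intro powr_mono2') auto
    then have "(s - 1) * (?x + 1) powr (- s) \<le> ?x powr (1 - s) - (?x + 1) powr (1 - s)"
      using z(3) assms mult_left_mono[of "(?x + 1) powr (- s)" "z powr (- s)" "s - 1"] by (simp add: algebra_simps)
    then have "(?x + 1) powr (- s) \<le> (?x powr (1 - s) - (?x + 1) powr (1 - s)) / (s - 1)"
      using assms by (simp add: pos_le_divide_eq mult.commute)
    then have *: "(?x + 1) powr (- s) \<le> ?x powr (1 - s) / (s - 1) - (?x + 1) powr (1 - s) / (s - 1)"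
      by (simp only: diff_divide_distrib)
    have "{d<..<d + Suc m} = insert (d + m) {d<..<d + m}" using step by auto
    then have "(\<Sum>t\<in>{d<..<d + Suc m}. (1 + real t) powr (- s))
        = (?x + 1) powr (- s) + (\<Sum>t\<in>{d<..<d + m}. (1 + real t) powr (- s))"
      by (simp add: add_ac)
    with * step.IH show ?case by (simp add: add_ac)
  qed
  moreover have "0 \<le> (real d + real (Suc X)) powr (1 - s) / (s - 1)"
    using assms by simp
  ultimately have "(\<Sum>t\<in>{d<..<d + Suc X}. (1 + real t) powr (- s)) \<le> (1 + real d) powr (1 - s) / (s - 1)"
    by (smt (verit) le_add1 plus_1_eq_Suc)
  moreover have "(\<Sum>t\<in>{d<..<X}. (1 + real t) powr (- s)) \<le> (\<Sum>t\<in>{d<..<d + Suc X}. (1 + real t) powr (- s))"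
    by (intro sum_mono2) auto
  ultimately show ?thesis by linarith
qed

text \<open>
  Each distance from \<open>a\<close> is attained by at most two integers.
\<close>

lemma sum_int_dist_le:
  fixes F :: "nat \<Rightarrow> real" and a :: int
  assumes "finite W" "\<And>t. 0 \<le> F t" "\<And>m. m \<in> W \<Longrightarrow> nat \<bar>a - m\<bar> < X"
  shows "(\<Sum>m\<in>W. F (nat \<bar>a - m\<bar>)) \<le> 2 * (\<Sum>t<X. F t)"
proof -
  have part: "(\<Sum>m\<in>V. F (nat \<bar>a - m\<bar>)) \<le> (\<Sum>t<X. F t)"
    if "V \<subseteq> W" "inj_on (\<lambda>m. nat \<bar>a - m\<bar>) V" for V
  proof -
    have "(\<Sum>m\<in>V. F (nat \<bar>a - m\<bar>)) = (\<Sum>t\<in>(\<lambda>m. nat \<bar>a - m\<bar>) ` V. F t)"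
      using that by (simp add: sum.reindex)
    also have "\<dots> \<le> (\<Sum>t<X. F t)"
      using that assms by (intro sum_mono2) auto
    finally show ?thesis .
  qed
  have "(\<Sum>m\<in>W. F (nat \<bar>a - m\<bar>))
      = (\<Sum>m\<in>{m\<in>W. m \<le> a}. F (nat \<bar>a - m\<bar>)) + (\<Sum>m\<in>{m\<in>W. a < m}. F (nat \<bar>a - m\<bar>))"
    using assms(1) by (subst sum.union_disjoint[symmetric]) (auto intro!: sum.cong)
  also have "\<dots> \<le> 2 * (\<Sum>t<X. F t)"
  proof -
    have "inj_on (\<lambda>m. nat \<bar>a - m\<bar>) {m\<in>W. m \<le> a}" "inj_on (\<lambda>m. nat \<bar>a - m\<bar>) {m\<in>W. a < m}"
      by (auto simp: inj_on_def)
    then show ?thesis using part[of "{m\<in>W. m \<le> a}"] part[of "{m\<in>W. a < m}"] by auto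
  qed
  finally show ?thesis .
qed

definition decay :: "real \<Rightarrow> int \<Rightarrow> real" where
  "decay s d = (1 + real (nat \<bar>d\<bar>)) powr (- s)"

lemma decay_pos: "0 < decay s d" by (simp add: decay_def)
lemma decay_minus: "decay s (a - b) = decay s (b - a)"
  by (simp add: decay_def abs_minus_commute)

text \<open>
  Points at distance at least \<open>card I\<close> from \<open>k\<close> contribute at most \<open>card I powr (- s)\<close> each, and
  the others at most what an interval around \<open>k\<close> contributes.  The bound is therefore uniform in \<open>k\<close> and
  depends on \<open>I\<close> only through its size.
\<close>

lemma sum_decay_le:
  assumes "0 < s" "s < 1" "finite I"
  shows "(\<Sum>l\<in>I. decay s (k - l)) \<le> (1 + 2 / (1 - s)) * real (card I) powr (1 - s)"
proof -
  let ?n = "card I"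
  let ?near = "{l\<in>I. nat \<bar>k - l\<bar> < ?n}" and ?far = "{l\<in>I. \<not> nat \<bar>k - l\<bar> < ?n}"
  have "(\<Sum>l\<in>I. decay s (k - l)) = (\<Sum>l\<in>?near. decay s (k - l)) + (\<Sum>l\<in>?far. decay s (k - l))"
    using assms(3) by (subst sum.union_disjoint[symmetric]) (auto intro!: sum.cong)
  also have "(\<Sum>l\<in>?near. decay s (k - l)) \<le> 2 * (\<Sum>t<?n. (1 + real t) powr (- s))"
    unfolding decay_def using assms(3)
    by (intro sum_int_dist_le[where F = "\<lambda>t. (1 + real t) powr (- s)"]) auto
  also have "\<dots> \<le> 2 / (1 - s) * real ?n powr (1 - s)"
    using sum_powr_le[OF assms(1,2), of ?n] by simp
  also have "(\<Sum>l\<in>?far. decay s (k - l)) \<le> real ?n powr (1 - s)"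
  proof (cases "?n = 0")
    case True then show ?thesis using assms(3) by simp
  next
    case False
    have "(\<Sum>l\<in>?far. decay s (k - l)) \<le> (\<Sum>l\<in>?far. real ?n powr (- s))"
      unfolding decay_def using False assms by (intro sum_mono powr_mono2') auto
    also have "\<dots> \<le> real ?n * real ?n powr (- s)"
      using assms(3) by (simp add: card_mono mult_right_mono)
    also have "\<dots> = real ?n powr (1 - s)"
      using False by (simp add: powr_mult_base)
    finally show ?thesis .
  qed
  finally show ?thesis by (simp add: algebra_simps)
qed

text \<open>
  Let \<open>t\<close> be the distance from \<open>m\<close> to the nearer of \<open>a\<close> and \<open>b\<close>.  The distance to the other one is at
  least \<open>t\<close>, and at least half of that between \<open>a\<close> and \<open>b\<close>; this gives the term with the maximum.
\<close>

lemma decay_mult_le: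
  fixes a b m :: int
  assumes "0 < s"
  defines "d \<equiv> nat \<bar>a - b\<bar>"
  defines "F \<equiv> \<lambda>t. (1 + real t) powr (- s) * max (1 + real t) ((1 + real d) / 2) powr (- s)"
  shows "decay s (a - m) * decay s (b - m) \<le> F (nat \<bar>a - m\<bar>) + F (nat \<bar>b - m\<bar>)"
proof -
  have *: "decay s (a - m) * decay s (b - m) \<le> (1 + real (nat \<bar>a - m\<bar>)) powr (- s)
      * max (1 + real (nat \<bar>a - m\<bar>)) ((1 + real (nat \<bar>a - b\<bar>)) / 2) powr (- s)"
    if "nat \<bar>a - m\<bar> \<le> nat \<bar>b - m\<bar>" for a b
  proof -
    have "nat \<bar>a - b\<bar> \<le> 2 * nat \<bar>b - m\<bar>" using that by arith
    then have "real (nat \<bar>a - b\<bar>) \<le> 2 * real (nat \<bar>b - m\<bar>)" by linarith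
    then have "max (1 + real (nat \<bar>a - m\<bar>)) ((1 + real (nat \<bar>a - b\<bar>)) / 2) \<le> 1 + real (nat \<bar>b - m\<bar>)"
      using that by (simp add: field_simps)
    then show ?thesis unfolding decay_def using assms(1)
      by (intro mult_left_mono powr_mono2') auto
  qed
  have F_nonneg: "0 \<le> F t" for t by (simp add: F_def)
  show ?thesis
  proof (cases "nat \<bar>a - m\<bar> \<le> nat \<bar>b - m\<bar>")
    case True
    then show ?thesis using *[OF True] F_nonneg[of "nat \<bar>b - m\<bar>"] unfolding F_def d_def by linarith
  next
    case False
    then have "decay s (b - m) * decay s (a - m) \<le> F (nat \<bar>b - m\<bar>)"
      using *[of b a] unfolding F_def d_def abs_minus_commute[of b a] by linarith
    then show ?thesis using F_nonneg[of "nat \<bar>a - m\<bar>"] by (simp add: mult.commute)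
  qed
qed

text \<open>
  Let \<open>d = 1 + \<bar>a - b\<bar>\<close>.  The points \<open>m\<close> within distance \<open>d\<close> of \<open>a\<close> or \<open>b\<close> contribute at most the order of
  \<open>d powr (- s) * d powr (1 - s)\<close>, and the others the tail beyond \<open>d\<close> of the series of
  \<open>t powr (- 2 * s)\<close>, which converges as \<open>1 / 2 < s\<close>; both are of order \<open>d powr (1 - 2 * s)\<close>.
\<close>

lemma decay_convolution:
  assumes "1 / 2 < s" "s < 1"
  obtains C where "0 < C" "\<And>W a b. finite W \<Longrightarrow>
    (\<Sum>m\<in>W. decay s (a - m) * decay s (b - m)) \<le> C * decay (2 * s - 1) (a - b)"
proof
  define C where "C = 4 * (2 powr s / (1 - s) + 1 / (2 * s - 1))"
  show "0 < C" using assms unfolding C_def by (simp add: add_pos_pos)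
  fix W :: "int set" and a b :: int assume W: "finite W"
  define d where "d = nat \<bar>a - b\<bar>"
  define F where "F t = (1 + real t) powr (- s) * max (1 + real t) ((1 + real d) / 2) powr (- s)" for t
  define X where "X = Suc (Max (insert 0 ((\<lambda>m. nat \<bar>a - m\<bar>) ` W \<union> (\<lambda>m. nat \<bar>b - m\<bar>) ` W)))"
  have X: "nat \<bar>a - m\<bar> < X" "nat \<bar>b - m\<bar> < X" if "m \<in> W" for m
    unfolding X_def using W that by (auto simp: less_Suc_eq_le intro!: Max_ge)
  have F_nonneg: "0 \<le> F t" for t by (simp add: F_def)
  have "(\<Sum>t<X. F t) \<le> (\<Sum>t\<in>{..<Suc d} \<union> {d<..<X}. F t)"
    using F_nonneg by (intro sum_mono2) auto
  also have "\<dots> = (\<Sum>t<Suc d. F t) + (\<Sum>t\<in>{d<..<X}. F t)"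
    by (intro sum.union_disjoint) auto
  also have "(\<Sum>t<Suc d. F t) \<le> (\<Sum>t<Suc d. (1 + real t) powr (- s)) * ((1 + real d) / 2) powr (- s)"
    unfolding sum_distrib_right F_def using assms
    by (intro sum_mono mult_left_mono powr_mono2') auto
  also have "\<dots> \<le> (1 + real d) powr (1 - s) / (1 - s) * ((1 + real d) / 2) powr (- s)"
    using sum_powr_le[of s "Suc d"] assms by (intro mult_right_mono) auto
  also have "\<dots> = 2 powr s / (1 - s) * (1 + real d) powr (1 - 2 * s)"
  proof -
    have "((1 + real d) / 2) powr (- s) = 2 powr s * (1 + real d) powr (- s)"
      by (simp add: powr_divide powr_minus_divide)
    moreover have "(1 + real d) powr (1 - 2 * s) = (1 + real d) powr (1 - s) * (1 + real d) powr (- s)"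
      by (simp add: powr_add[symmetric])
    ultimately show ?thesis by (simp only: times_divide_eq_left times_divide_eq_right mult_ac)
  qed
  also have "(\<Sum>t\<in>{d<..<X}. F t) \<le> (\<Sum>t\<in>{d<..<X}. (1 + real t) powr (- (2 * s)))"
  proof (intro sum_mono)
    fix t
    have "F t \<le> (1 + real t) powr (- s) * (1 + real t) powr (- s)"
      unfolding F_def using assms by (intro mult_left_mono powr_mono2') auto
    then show "F t \<le> (1 + real t) powr (- (2 * s))" by (simp add: powr_add[symmetric])
  qed
  also have "\<dots> \<le> (1 + real d) powr (1 - 2 * s) / (2 * s - 1)"
    using sum_powr_tail_le[of "2 * s" d X] assms by simp
  finally have sumF: "(\<Sum>t<X. F t) \<le> C / 4 * (1 + real d) powr (1 - 2 * s)"
    by (simp add: C_def algebra_simps)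
  have "(\<Sum>m\<in>W. decay s (a - m) * decay s (b - m))
      \<le> (\<Sum>m\<in>W. F (nat \<bar>a - m\<bar>) + F (nat \<bar>b - m\<bar>))"
    unfolding F_def d_def using decay_mult_le[of s a _ b] assms by (intro sum_mono) auto
  also have "\<dots> \<le> 2 * (\<Sum>t<X. F t) + 2 * (\<Sum>t<X. F t)"
    unfolding sum.distrib using W X F_nonneg by (intro add_mono sum_int_dist_le) auto
  also have "\<dots> \<le> C * (1 + real d) powr (1 - 2 * s)" using sumF by simp
  finally show "(\<Sum>m\<in>W. decay s (a - m) * decay s (b - m)) \<le> C * decay (2 * s - 1) (a - b)"
    by (simp add: decay_def d_def)
qed

text \<open>
  By the triangle inequality one of the distances \<open>\<bar>l - m\<bar>\<close> and \<open>\<bar>k - m\<bar>\<close> is at least of the order of \<open>\<bar>k - l\<bar>\<close>.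
  The exponents are such that the power \<open>2 * s - 1\<close> of \<open>\<bar>k - l\<bar>\<close> can always be extracted while
  leaving the power \<open>s\<close> of the other distance: if the small factor is \<open>decay s (l - m)\<close>, only
  the part with exponent \<open>- (2 * s - 1)\<close> is spent, and in the rest, with exponent \<open>- (1 - s)\<close>, the
  distance \<open>\<bar>l - m\<bar>\<close> can be replaced by the smaller \<open>\<bar>k - m\<bar>\<close>.
\<close>

lemma decay_mult_decay_le:
  assumes "1 / 2 < s" "s < 1"
  shows "decay s (l - m) * decay (2 * s - 1) (k - m)
      \<le> 2 powr (2 * s - 1) * decay (2 * s - 1) (k - l) * (decay s (l - m) + decay s (k - m))"
proof -
  define x y z where "x = 1 + real (nat \<bar>l - m\<bar>)" and "y = 1 + real (nat \<bar>k - m\<bar>)"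
    and "z = (1 + real (nat \<bar>k - l\<bar>)) / 2"
  define u where "u = 2 * s - 1"
  have pos: "1 \<le> x" "1 \<le> y" "0 < z" "0 < u"
    using assms by (auto simp: x_def y_def z_def u_def)
  have "nat \<bar>k - l\<bar> \<le> nat \<bar>l - m\<bar> + nat \<bar>k - m\<bar>" by arith
  then have "real (nat \<bar>k - l\<bar>) \<le> real (nat \<bar>l - m\<bar>) + real (nat \<bar>k - m\<bar>)" by linarith
  then have xyz: "z \<le> x \<or> z \<le> y"
    unfolding x_def y_def z_def by argo
  have "x powr (- s) * y powr (- u) \<le> z powr (- u) * (x powr (- s) + y powr (- s))"
  proof (cases "z \<le> y")
    case True
    then have "y powr (- u) \<le> z powr (- u)" using pos by (intro powr_mono2') auto
    then have "x powr (- s) * y powr (- u) \<le> x powr (- s) * z powr (- u)" by (intro mult_left_mono) auto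
    also have "\<dots> \<le> z powr (- u) * (x powr (- s) + y powr (- s))" by (simp add: distrib_left mult.commute)
    finally show ?thesis .
  next
    case False
    then have zx: "z \<le> x" "y \<le> x" using xyz by auto
    have "x powr (- s) * y powr (- u) = x powr (- u) * (x powr (u - s) * y powr (- u))"
      by (simp add: powr_add[symmetric] flip: mult.assoc)
    also have "\<dots> \<le> z powr (- u) * (y powr (u - s) * y powr (- u))"
      using zx pos assms by (intro mult_mono powr_mono2') (auto simp: u_def)
    also have "\<dots> = z powr (- u) * y powr (- s)" by (simp add: powr_add[symmetric])
    also have "\<dots> \<le> z powr (- u) * (x powr (- s) + y powr (- s))" by (intro mult_left_mono) auto
    finally show ?thesis .
  qed
  moreover have "z powr (- u) = 2 powr u * decay u (k - l)"
    by (simp add: z_def decay_def powr_divide powr_minus_divide)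
  ultimately show ?thesis by (simp add: decay_def x_def y_def u_def)
qed

section \<open>Averages of genealogy weights\<close>

text \<open>
  The constant \<open>K\<close> is that of \<open>decay_convolution\<close>; having it as a parameter makes the constants in all
  bounds explicit and independent of the window \<open>W\<close>.
\<close>

locale dominated_kernel =
  fixes w :: "int \<Rightarrow> real" and W :: "int set" and \<beta> C K :: real
  assumes w_nonneg: "0 \<le> w d"
    and w_le: "w d \<le> C * decay \<beta> d"
    and finite_W: "finite W"
    and \<beta>: "1 / 2 < \<beta>" "\<beta> < 1"
    and convolution: "(\<Sum>m\<in>W. decay \<beta> (a - m) * decay \<beta> (b - m)) \<le> K * decay (2 * \<beta> - 1) (a - b)"
begin

lemma C_nonneg: "0 \<le> C"
proof -
  have "0 \<le> C * decay \<beta> 0" using w_nonneg w_le order_trans by blast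
  then show ?thesis using decay_pos[of \<beta> 0] by (simp add: zero_le_mult_iff)
qed

lemma K_nonneg: "0 \<le> K"
proof -
  have "0 \<le> (\<Sum>m\<in>W. decay \<beta> (0 - m) * decay \<beta> (0 - m))"
    by (intro sum_nonneg) simp
  also have "\<dots> \<le> K * decay (2 * \<beta> - 1) 0" using convolution[of 0 0] by simp
  finally show ?thesis using decay_pos[of "2 * \<beta> - 1" 0] by (simp add: zero_le_mult_iff)
qed

lemma w_mult_le: "w a * w b \<le> C\<^sup>2 * (decay \<beta> a * decay \<beta> b)"
proof -
  have "w a * w b \<le> (C * decay \<beta> a) * (C * decay \<beta> b)"
    by (intro mult_mono w_le w_nonneg order_trans[OF w_nonneg w_le])
  then show ?thesis by (simp add: power2_eq_square mult_ac)
qed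

lemma pair_weight_le: "pair_weight w W a b \<le> C\<^sup>2 * K * decay (2 * \<beta> - 1) (a - b)"
proof -
  have "pair_weight w W a b \<le> (\<Sum>k\<in>W. C\<^sup>2 * (decay \<beta> (a - k) * decay \<beta> (b - k)))"
    unfolding pair_weight_def merge_def using w_mult_le by (intro sum_mono) simp
  also have "\<dots> \<le> C\<^sup>2 * (K * decay (2 * \<beta> - 1) (a - b))"
    unfolding sum_distrib_left[symmetric] by (intro mult_left_mono convolution) simp
  finally show ?thesis by (simp add: mult.assoc)
qed

definition spread :: "nat \<Rightarrow> real" where
  "spread n = (1 + 2 / (1 - (2 * \<beta> - 1))) * real n powr (1 - (2 * \<beta> - 1))"

lemma spread_nonneg: "0 \<le> spread n"
  using \<beta> by (simp add: spread_def)

lemma sum_decay_le_spread: "finite I \<Longrightarrow> (\<Sum>l\<in>I. decay (2 * \<beta> - 1) (k - l)) \<le> spread (card I)"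
  unfolding spread_def using \<beta> by (intro sum_decay_le) auto

text \<open>
  Bounds the total pair weight of one vertex with a set of \<open>n\<close> vertices; for the renewal weights this
  bounds the expected number of vertices of the set whose path meets that of the given vertex.
\<close>

definition partners :: "nat \<Rightarrow> real" where
  "partners n = C\<^sup>2 * K * spread n"

lemma partners_nonneg: "0 \<le> partners n"
  using K_nonneg spread_nonneg by (simp add: partners_def)

lemma sum_pair_weight_le:
  assumes "finite I"
  shows "(\<Sum>l\<in>I. pair_weight w W k l) \<le> partners (card I)"
proof -
  have "(\<Sum>l\<in>I. pair_weight w W k l) \<le> (\<Sum>l\<in>I. C\<^sup>2 * K * decay (2 * \<beta> - 1) (k - l))"
    by (intro sum_mono pair_weight_le)
  also have "\<dots> \<le> C\<^sup>2 * K * spread (card I)"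
    unfolding sum_distrib_left[symmetric] using K_nonneg assms
    by (intro mult_left_mono sum_decay_le_spread) auto
  finally show ?thesis by (simp add: partners_def)
qed

text \<open>
  The paths from \<open>a\<close> and \<open>b\<close> merge at some \<open>m\<close> and then meet the path from \<open>c\<close>.  The last meeting costs
  a power of \<open>\<bar>c - m\<bar>\<close>; extracting the distance from \<open>c\<close> to \<open>a\<close> with \<open>decay_mult_decay_le\<close> leaves two
  convolutions over \<open>m\<close>.
\<close>

lemma merge_pair_weight_le:
  "merge w W a b (\<lambda>m. pair_weight w W m c)
    \<le> 2 * C ^ 4 * K\<^sup>2 * decay (2 * \<beta> - 1) (c - a) * (decay (2 * \<beta> - 1) (a - b) + decay (2 * \<beta> - 1) (c - b))"
proof -
  let ?u = "2 * \<beta> - 1"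
  have two: "2 powr ?u \<le> 2" using \<beta> powr_mono[of ?u 1 2] by simp
  have "w (a - m) * w (b - m) * pair_weight w W m c
      \<le> 2 * C ^ 4 * K * decay ?u (c - a) * (decay \<beta> (a - m) * decay \<beta> (b - m) + decay \<beta> (c - m) * decay \<beta> (b - m))" for m
  proof -
    have "w (a - m) * w (b - m) * pair_weight w W m c
      \<le> (C\<^sup>2 * (decay \<beta> (a - m) * decay \<beta> (b - m))) * (C\<^sup>2 * K * decay ?u (m - c))"
      by (intro mult_mono[OF w_mult_le pair_weight_le])
        (auto simp: pair_weight_def merge_def intro!: sum_nonneg mult_nonneg_nonneg w_nonneg less_imp_le[OF decay_pos])
    also have "\<dots> = C ^ 4 * K * decay \<beta> (b - m) * (decay \<beta> (a - m) * decay ?u (c - m))"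
      by (simp add: decay_minus[of _ m c] power2_eq_square power4_eq_xxxx mult_ac)
    also have "\<dots> \<le> C ^ 4 * K * decay \<beta> (b - m)
        * (2 powr ?u * decay ?u (c - a) * (decay \<beta> (a - m) + decay \<beta> (c - m)))"
      using K_nonneg less_imp_le[OF decay_pos] \<beta>
      by (intro mult_left_mono decay_mult_decay_le mult_nonneg_nonneg) auto
    also have "\<dots> \<le> C ^ 4 * K * decay \<beta> (b - m)
        * (2 * decay ?u (c - a) * (decay \<beta> (a - m) + decay \<beta> (c - m)))"
      using K_nonneg less_imp_le[OF decay_pos]
      by (intro mult_left_mono mult_right_mono two mult_nonneg_nonneg add_nonneg_nonneg) auto
    finally show ?thesis by (simp add: algebra_simps)
  qed
  then have "merge w W a b (\<lambda>m. pair_weight w W m c)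
      \<le> (\<Sum>m\<in>W. 2 * C ^ 4 * K * decay ?u (c - a) * (decay \<beta> (a - m) * decay \<beta> (b - m) + decay \<beta> (c - m) * decay \<beta> (b - m)))"
    unfolding merge_def by (rule sum_mono)
  also have "\<dots> \<le> 2 * C ^ 4 * K * decay ?u (c - a) * (K * decay ?u (a - b) + K * decay ?u (c - b))"
    unfolding sum_distrib_left[symmetric] sum.distrib using K_nonneg less_imp_le[OF decay_pos]
    by (intro mult_left_mono add_mono convolution mult_nonneg_nonneg) auto
  finally show ?thesis by (simp add: algebra_simps power2_eq_square)
qed

lemma sum_merge_pair_weight_le:
  assumes "finite I"
  shows "(\<Sum>l\<in>I. \<Sum>p\<in>I. merge w W l p (\<lambda>m. pair_weight w W m k)) \<le> 4 * (partners (card I))\<^sup>2"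
proof -
  let ?u = "2 * \<beta> - 1"
  let ?S = "spread (card I)"
  have "(\<Sum>l\<in>I. \<Sum>p\<in>I. merge w W l p (\<lambda>m. pair_weight w W m k))
      \<le> (\<Sum>l\<in>I. \<Sum>p\<in>I. 2 * C ^ 4 * K\<^sup>2 * decay ?u (k - l) * (decay ?u (l - p) + decay ?u (k - p)))"
    by (intro sum_mono merge_pair_weight_le)
  also have "\<dots> = (\<Sum>l\<in>I. 2 * C ^ 4 * K\<^sup>2 * decay ?u (k - l)
      * ((\<Sum>p\<in>I. decay ?u (l - p)) + (\<Sum>p\<in>I. decay ?u (k - p))))"
    by (simp only: sum_distrib_left[symmetric] sum.distrib)
  also have "\<dots> \<le> (\<Sum>l\<in>I. 2 * C ^ 4 * K\<^sup>2 * decay ?u (k - l) * (?S + ?S))"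
    using assms less_imp_le[OF decay_pos]
    by (intro sum_mono mult_left_mono add_mono sum_decay_le_spread mult_nonneg_nonneg) auto
  also have "\<dots> = 2 * C ^ 4 * K\<^sup>2 * (?S + ?S) * (\<Sum>l\<in>I. decay ?u (k - l))"
    by (simp add: sum_distrib_left mult_ac)
  also have "\<dots> \<le> 2 * C ^ 4 * K\<^sup>2 * (?S + ?S) * ?S"
    using assms spread_nonneg
    by (intro mult_left_mono sum_decay_le_spread mult_nonneg_nonneg) auto
  also have "\<dots> = 4 * (partners (card I))\<^sup>2"
    by (simp add: partners_def power2_eq_square power4_eq_xxxx mult_ac)
  finally show ?thesis .
qed

lemma sum_merge_le:
  assumes "\<And>k. k \<in> W \<Longrightarrow> (\<Sum>p\<in>I. G k p) \<le> T"
  shows "(\<Sum>p\<in>I. merge w W a b (\<lambda>k. G k p)) \<le> T * pair_weight w W a b"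
proof -
  have "(\<Sum>p\<in>I. merge w W a b (\<lambda>k. G k p)) = (\<Sum>k\<in>W. w (a - k) * w (b - k) * (\<Sum>p\<in>I. G k p))"
    unfolding merge_def sum_distrib_left by (rule sum.swap)
  also have "\<dots> \<le> (\<Sum>k\<in>W. w (a - k) * w (b - k) * T)"
    using assms w_nonneg by (intro sum_mono mult_left_mono) auto
  finally show ?thesis
    by (simp add: pair_weight_def merge_def sum_distrib_left mult_ac)
qed

text \<open>
  In two of the three genealogies the given path from \<open>k\<close> takes part in the first merger, and
  \<open>sum_pair_weight_le\<close> applies twice; the third is \<open>sum_merge_pair_weight_le\<close>.
\<close>

lemma sum_triple_weight_le:
  assumes "finite I"
  shows "(\<Sum>l\<in>I. \<Sum>p\<in>I. triple_weight w W k l p) \<le> 6 * (partners (card I))\<^sup>2"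
proof -
  let ?B = "partners (card I)"
  have first: "(\<Sum>l\<in>I. \<Sum>p\<in>I. merge w W k l (\<lambda>m. pair_weight w W m p)) \<le> ?B\<^sup>2"
  proof -
    have "(\<Sum>l\<in>I. \<Sum>p\<in>I. merge w W k l (\<lambda>m. pair_weight w W m p)) \<le> (\<Sum>l\<in>I. ?B * pair_weight w W k l)"
      using assms by (intro sum_mono sum_merge_le sum_pair_weight_le)
    also have "\<dots> \<le> ?B * ?B"
      unfolding sum_distrib_left[symmetric] using assms
      by (intro mult_left_mono sum_pair_weight_le partners_nonneg)
    finally show ?thesis by (simp add: power2_eq_square)
  qed
  have "(\<Sum>l\<in>I. \<Sum>p\<in>I. merge w W k p (\<lambda>m. pair_weight w W m l))
      = (\<Sum>l\<in>I. \<Sum>p\<in>I. merge w W k l (\<lambda>m. pair_weight w W m p))"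
    by (rule sum.swap)
  with first sum_merge_pair_weight_le[OF assms, of k] show ?thesis
    by (simp add: triple_weight_def sum.distrib)
qed

text \<open>
  By symmetry the six choices of the first pair contribute equally.  After the first merger, at \<open>k\<close>,
  \<open>sum_triple_weight_le\<close> bounds the rest uniformly in \<open>k\<close>; the sum over \<open>k\<close> and over the first pair is then a sum of
  pair weights.
\<close>

lemma sum_quadruple_weight_le:
  assumes "finite I"
  shows "(\<Sum>a\<in>I. \<Sum>b\<in>I. \<Sum>c\<in>I. \<Sum>d\<in>I. quadruple_weight w W a b c d)
    \<le> 36 * real (card I) * partners (card I) ^ 3"
proof -
  let ?B = "partners (card I)"
  let ?G = "\<lambda>a b c d. merge w W a b (\<lambda>k. triple_weight w W k c d)"
  let ?T = "\<Sum>a\<in>I. \<Sum>b\<in>I. \<Sum>c\<in>I. \<Sum>d\<in>I. ?G a b c d"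
  have "(\<Sum>c\<in>I. \<Sum>d\<in>I. ?G a b c d) \<le> 6 * ?B\<^sup>2 * pair_weight w W a b" for a b
    using sum_merge_le[where I = "I \<times> I" and G = "\<lambda>k (c, d). triple_weight w W k c d" and T = "6 * ?B\<^sup>2" and a = a and b = b]
      sum_triple_weight_le[OF assms]
    by (simp add: sum.cartesian_product[symmetric] case_prod_unfold sum.cartesian_product')
  then have "?T \<le> (\<Sum>a\<in>I. \<Sum>b\<in>I. 6 * ?B\<^sup>2 * pair_weight w W a b)"
    by (intro sum_mono)
  also have "\<dots> = 6 * ?B\<^sup>2 * (\<Sum>a\<in>I. \<Sum>b\<in>I. pair_weight w W a b)"
    by (simp add: sum_distrib_left)
  also have "\<dots> \<le> 6 * ?B\<^sup>2 * (\<Sum>a\<in>I. ?B)"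
    using assms by (intro mult_left_mono sum_mono sum_pair_weight_le) auto
  finally have T: "?T \<le> 6 * real (card I) * ?B ^ 3"
    by (simp add: power2_eq_square power3_eq_cube mult_ac)
  have ac: "(\<Sum>a\<in>I. \<Sum>b\<in>I. \<Sum>c\<in>I. \<Sum>d\<in>I. ?G a c b d) = ?T"
    by (intro sum.cong refl sum.swap)
  have ad: "(\<Sum>a\<in>I. \<Sum>b\<in>I. \<Sum>c\<in>I. \<Sum>d\<in>I. ?G a d b c) = ?T"
    by (rule trans[OF _ ac], rule sum.cong[OF refl], rule sum.cong[OF refl], rule sum.swap)
  have bc: "(\<Sum>a\<in>I. \<Sum>b\<in>I. \<Sum>c\<in>I. \<Sum>d\<in>I. ?G b c a d) = ?T"
    by (subst sum.swap) (rule ac)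
  have bd: "(\<Sum>a\<in>I. \<Sum>b\<in>I. \<Sum>c\<in>I. \<Sum>d\<in>I. ?G b d a c) = ?T"
    by (subst sum.swap) (rule ad)
  have cd: "(\<Sum>a\<in>I. \<Sum>b\<in>I. \<Sum>c\<in>I. \<Sum>d\<in>I. ?G c d a b) = ?T"
    by (rule trans[OF _ bd], rule sum.cong[OF refl], rule sum.swap)
  show ?thesis
    unfolding quadruple_weight_def sum.distrib ac ad bc bd cd using T by simp
qed

end

section \<open>Decay of the renewal weights\<close>

text \<open>
  Slow variation of \<open>L\<close> makes the tail \<open>T\<close> satisfy \<open>T (2 * n) \<ge> 2 powr (- (\<alpha> + \<epsilon>)) * T n\<close> for large \<open>n\<close>.
  The argument is halved repeatedly; that \<open>T\<close> is monotone deals with rounding.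
\<close>

lemma tail_lower_bound:
  fixes \<alpha> \<epsilon> :: real
  assumes "0 < \<epsilon>" "0 < \<alpha>"
    and L_pos: "\<And>x. 0 < L x"
    and L_sv: "slowly_varying L"
    and tail: "(\<lambda>n. measure_pmf.prob \<mu> {n..}) \<sim>[at_top] (\<lambda>n. real n powr (-\<alpha>) * L (real n))"
  shows "\<exists>c>0. eventually (\<lambda>n. c * real n powr (- (\<alpha> + \<epsilon>)) \<le> measure_pmf.prob \<mu> {n..}) sequentially"
proof -
  define \<gamma> where "\<gamma> = \<alpha> + \<epsilon>"
  define T where "T n = measure_pmf.prob \<mu> {n..}" for n :: nat
  define g where "g n = real n powr (-\<alpha>) * L (real n)" for n :: nat
  have Tg: "T \<sim>[at_top] g" using tail by (simp add: T_def[abs_def] g_def[abs_def])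
  have dbl: "filterlim (\<lambda>n. 2 * n :: nat) at_top at_top"
    by (rule filterlim_subseq) (simp add: strict_mono_def)
  have "((\<lambda>x. L (2 * x) / L x) \<longlongrightarrow> 1) at_top"
    using L_sv by (simp add: slowly_varying_def)
  then have "(\<lambda>n. L (2 * real n) / L (real n)) \<longlonglongrightarrow> 1"
    by (rule filterlim_compose) (rule filterlim_real_sequentially)
  then have "(\<lambda>n. 2 powr (-\<alpha>) * (L (2 * real n) / L (real n))) \<longlonglongrightarrow> 2 powr (-\<alpha>) * 1"
    by (intro tendsto_mult tendsto_const)
  moreover have "eventually (\<lambda>n. 2 powr (-\<alpha>) * (L (2 * real n) / L (real n)) = g (2 * n) / g n) sequentially"
    using eventually_gt_at_top[of 0] by eventually_elim (simp add: g_def powr_mult)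
  ultimately have "(\<lambda>n. g (2 * n) / g n) \<longlonglongrightarrow> 2 powr (-\<alpha>)"
    by (simp add: tendsto_cong)
  moreover have "(\<lambda>n. T (2 * n) / T n) \<sim>[at_top] (\<lambda>n. g (2 * n) / g n)"
    by (intro asymp_equiv_intros Tg asymp_equiv_compose'[OF Tg dbl])
  ultimately have "(\<lambda>n. T (2 * n) / T n) \<longlonglongrightarrow> 2 powr (-\<alpha>)"
    using asymp_equiv_symI tendsto_asymp_equiv_cong by blast
  moreover have "2 powr (-\<gamma>) < 2 powr (-\<alpha>)" using assms by (simp add: \<gamma>_def)
  ultimately have ev1: "eventually (\<lambda>n. 2 powr (-\<gamma>) < T (2 * n) / T n) sequentially"
    by (rule order_tendstoD)
  have ev2: "eventually (\<lambda>n. 0 < T n) sequentially"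
  proof -
    have "eventually (\<lambda>n. T n \<noteq> 0 \<or> g n = 0) sequentially"
      using asymp_equiv_eventually_zeros[OF Tg] by (rule eventually_mono) auto
    moreover have "eventually (\<lambda>n. g n \<noteq> 0) sequentially"
      using eventually_gt_at_top[of 0]
    proof eventually_elim
      case (elim n) then show ?case using L_pos[of "real n"] by (simp add: g_def)
    qed
    ultimately show ?thesis
      by eventually_elim (auto simp: T_def less_le)
  qed
  obtain n0 where n0: "2 \<le> n0" "\<And>n. n0 \<le> n \<Longrightarrow> 2 powr (-\<gamma>) < T (2 * n) / T n" "\<And>n. n0 \<le> n \<Longrightarrow> 0 < T n"
  proof -
    have "eventually (\<lambda>n. 2 powr (-\<gamma>) < T (2 * n) / T n \<and> 0 < T n \<and> 2 \<le> n) sequentially"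
      using ev1 ev2 eventually_ge_at_top by eventually_elim auto
    then show ?thesis using that unfolding eventually_sequentially by (metis order_refl)
  qed
  have T_mono: "T n \<le> T m" if "m \<le> n" for m n
    unfolding T_def using that by (intro measure_pmf.finite_measure_mono) auto
  define c where "c = T (2 * n0)"
  have c: "0 < c" using n0(3)[of "2 * n0"] by (simp add: c_def)
  \<comment> \<open>The shift by \<open>1\<close> absorbs the rounding in \<open>m = (n + 1) div 2\<close>, as \<open>2 * (m - 1) \<le> n - 1\<close>.\<close>
  have bound: "c * (real n - 1) powr (-\<gamma>) \<le> T n" if "n0 \<le> n" for n
    using that
  proof (induction n rule: less_induct)
    case (less n)
    show ?case
    proof (cases "n < 2 * n0")
      case True
      have "(real n - 1) powr (-\<gamma>) \<le> 1 powr (-\<gamma>)"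
        using less.prems n0(1) assms by (intro powr_mono2') (auto simp: \<gamma>_def)
      then have "c * (real n - 1) powr (-\<gamma>) \<le> c" using c by simp
      also have "c \<le> T n" unfolding c_def using True by (intro T_mono) simp
      finally show ?thesis .
    next
      case False
      define m where "m = (n + 1) div 2"
      have m: "n0 \<le> m" "m < n" "n \<le> 2 * m" "2 * m \<le> n + 1"
        using False n0(1) by (auto simp: m_def)
      have "c * (real n - 1) powr (-\<gamma>) \<le> c * (2 * (real m - 1)) powr (-\<gamma>)"
        using m n0(1) c assms by (intro mult_left_mono powr_mono2') (auto simp: \<gamma>_def)
      also have "\<dots> = 2 powr (-\<gamma>) * (c * (real m - 1) powr (-\<gamma>))"
      proof -
        have "(2 * (real m - 1)) powr (-\<gamma>) = 2 powr (-\<gamma>) * (real m - 1) powr (-\<gamma>)"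
          by (rule powr_mult)
        then show ?thesis by (simp only: mult_ac)
      qed
      also have "\<dots> \<le> 2 powr (-\<gamma>) * T m"
        using less.IH[OF m(2,1)] by (intro mult_left_mono) auto
      also have "\<dots> \<le> T (2 * m)"
        using n0(2)[OF m(1)] n0(3)[OF m(1)] by (simp add: field_simps)
      also have "\<dots> \<le> T n" by (rule T_mono[OF m(3)])
      finally show ?thesis .
    qed
  qed
  have "c * real n powr (-\<gamma>) \<le> T n" if "n0 \<le> n" for n
  proof -
    have "c * real n powr (-\<gamma>) \<le> c * (real n - 1) powr (-\<gamma>)"
      using that n0(1) c assms by (intro mult_left_mono powr_mono2') (auto simp: \<gamma>_def)
    then show ?thesis using bound[OF that] by simp
  qed
  then show ?thesis
    using c unfolding T_def \<gamma>_def eventually_sequentially by blast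
qed

text \<open>
  If \<open>T n\<close> denotes the tail of \<open>\<mu>\<close>, then \<open>L n\<close> is of order \<open>n powr \<alpha> * T n\<close>, so the renewal weights are
  of order \<open>1 / (n * T n)\<close>, and \<open>tail_lower_bound\<close> applies.
\<close>

lemma renewal_weight_le_powr:
  fixes \<alpha> \<epsilon> :: real
  assumes "0 < \<epsilon>" "0 < \<alpha>" "\<alpha> + \<epsilon> < 1"
    and L_pos: "\<And>x. 0 < L x"
    and L_sv: "slowly_varying L"
    and tail: "(\<lambda>n. measure_pmf.prob \<mu> {n..}) \<sim>[at_top] (\<lambda>n. real n powr (-\<alpha>) * L (real n))"
    and renewal: "renewal_weight \<mu> \<sim>[at_top]
        (\<lambda>n. 1 / (Gamma \<alpha> * Gamma (1 - \<alpha>)) * (real n powr (\<alpha> - 1) / L (real n)))"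
  shows "\<exists>C. \<forall>n. renewal_weight \<mu> n \<le> C * (1 + real n) powr (- (1 - \<alpha> - \<epsilon>))"
proof -
  define \<beta> where "\<beta> = 1 - \<alpha> - \<epsilon>"
  define T where "T n = measure_pmf.prob \<mu> {n..}" for n :: nat
  define A where "A = 1 / (Gamma \<alpha> * Gamma (1 - \<alpha>))"
  obtain c where c: "0 < c" "eventually (\<lambda>n. c * real n powr (- (\<alpha> + \<epsilon>)) \<le> T n) sequentially"
    using tail_lower_bound[OF assms(1,2) L_pos L_sv tail] by (auto simp: T_def)
  have "T \<in> O(\<lambda>n. real n powr (-\<alpha>) * L (real n))"
    using tail by (simp add: T_def[abs_def] asymp_equiv_imp_bigo)
  then obtain D where D: "0 < D" "eventually (\<lambda>n. norm (T n) \<le> D * norm (real n powr (-\<alpha>) * L (real n))) sequentially"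
    by (elim landau_o.bigE)
  have "renewal_weight \<mu> \<in> O(\<lambda>n. A * (real n powr (\<alpha> - 1) / L (real n)))"
    using renewal by (simp add: A_def asymp_equiv_imp_bigo)
  also have "(\<lambda>n. A * (real n powr (\<alpha> - 1) / L (real n))) \<in> O(\<lambda>n. real n powr (-\<beta>))"
  proof (rule bigoI)
    show "eventually (\<lambda>n. norm (A * (real n powr (\<alpha> - 1) / L (real n))) \<le> \<bar>A\<bar> * D / c * norm (real n powr (-\<beta>))) sequentially"
      using c(2) D(2) eventually_gt_at_top[of 0]
    proof eventually_elim
      case (elim n)
      have L: "0 < L (real n)" by (rule L_pos)
      have "c * real n powr (- (\<alpha> + \<epsilon>)) \<le> D * (real n powr (-\<alpha>) * L (real n))"
        using elim L by (simp add: T_def)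
      then have "real n powr (-\<beta>) * (c * real n powr (- (\<alpha> + \<epsilon>))) \<le> real n powr (-\<beta>) * (D * (real n powr (-\<alpha>) * L (real n)))"
        by (intro mult_left_mono) auto
      moreover have "real n powr (-\<beta>) * real n powr (- (\<alpha> + \<epsilon>)) = real n powr (\<alpha> - 1) * real n powr (-\<alpha>)"
        by (simp add: powr_add[symmetric] \<beta>_def)
      ultimately have "real n powr (-\<alpha>) * (c * real n powr (\<alpha> - 1)) \<le> real n powr (-\<alpha>) * (D * real n powr (-\<beta>) * L (real n))"
        by (simp only: mult_ac)
      then have "c * real n powr (\<alpha> - 1) \<le> D * real n powr (-\<beta>) * L (real n)"
        using elim by (simp add: mult_le_cancel_left_pos)
      then have "real n powr (\<alpha> - 1) / L (real n) \<le> D / c * real n powr (-\<beta>)"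
        using L c(1) by (simp add: pos_divide_le_eq pos_le_divide_eq mult_ac)
      then have "\<bar>A\<bar> * (real n powr (\<alpha> - 1) / L (real n)) \<le> \<bar>A\<bar> * (D / c * real n powr (-\<beta>))"
        by (intro mult_left_mono) auto
      then show ?case using L by (simp add: abs_mult)
    qed
  qed
  finally have "renewal_weight \<mu> \<in> O(\<lambda>n. real n powr (-\<beta>))" .
  then obtain C where C: "0 < C" "eventually (\<lambda>n. norm (renewal_weight \<mu> n) \<le> C * norm (real n powr (-\<beta>))) sequentially"
    by (elim landau_o.bigE)
  then obtain N where N: "\<And>n. N \<le> n \<Longrightarrow> renewal_weight \<mu> n \<le> C * real n powr (-\<beta>)"
    by (auto simp: eventually_sequentially renewal_weight_nonneg)
  have \<beta>: "0 < \<beta>" using assms by (simp add: \<beta>_def)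
  define C' where "C' = C * 2 powr \<beta> + (\<Sum>k\<le>N. renewal_weight \<mu> k * (1 + real k) powr \<beta>)"
  have small: "0 \<le> (\<Sum>k\<le>N. renewal_weight \<mu> k * (1 + real k) powr \<beta>)"
    by (intro sum_nonneg) (simp add: renewal_weight_nonneg)
  have "renewal_weight \<mu> n \<le> C' * (1 + real n) powr (-\<beta>)" for n
  proof (cases "n \<le> N")
    case True
    have "renewal_weight \<mu> n * (1 + real n) powr \<beta> \<le> (\<Sum>k\<le>N. renewal_weight \<mu> k * (1 + real k) powr \<beta>)"
      using True by (intro member_le_sum) (auto simp: renewal_weight_nonneg)
    also have "\<dots> \<le> C'" using C(1) by (simp add: C'_def)
    finally have "renewal_weight \<mu> n * (1 + real n) powr \<beta> * (1 + real n) powr (-\<beta>) \<le> C' * (1 + real n) powr (-\<beta>)"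
      by (intro mult_right_mono) auto
    moreover have "(1 + real n) powr \<beta> * (1 + real n) powr (-\<beta>) = 1"
      by (simp add: powr_add[symmetric])
    ultimately show ?thesis by (simp add: mult.assoc)
  next
    case False
    have "real n powr (-\<beta>) \<le> ((1 + real n) / 2) powr (-\<beta>)"
      using False \<beta> by (intro powr_mono2') auto
    also have "\<dots> = 2 powr \<beta> * (1 + real n) powr (-\<beta>)"
      by (simp add: powr_divide powr_minus_divide)
    finally have "C * real n powr (-\<beta>) \<le> C * (2 powr \<beta> * (1 + real n) powr (-\<beta>))"
      using C(1) by (intro mult_left_mono) auto
    also have "\<dots> \<le> C' * (1 + real n) powr (-\<beta>)"
      unfolding C'_def mult.assoc[symmetric] using small by (intro mult_right_mono) auto
    finally show ?thesis using N[of n] False by simp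
  qed
  then show ?thesis unfolding \<beta>_def by blast
qed

section \<open>Sampled vertices\<close>

text \<open>
  Passage from fixed to uniformly sampled starting points.  The set \<open>K\<close> lists the possible
  values \<open>v t\<close> of the sample; each of them has probability at most \<open>(1 / n) ^ card J\<close> and is independent of
  the jumps.  Up to a null set, \<open>D\<close> is covered by an increasing union of coalescence events over the
  depth \<open>N\<close> of the window, so a bound uniform in \<open>N\<close> carries over to \<open>D\<close>.
\<close>

lemma (in prob_space) prob_sampled_coalescence_le:
  fixes X :: "int + nat \<Rightarrow> 'a \<Rightarrow> nat" and K :: "'t set" and v :: "'t \<Rightarrow> nat \<Rightarrow> nat"
  assumes indep: "indep_vars (\<lambda>_. count_space UNIV) X (UNIV <+> J)" and "finite J" "1 \<le> n"
    and uniform: "\<And>m. m \<in> J \<Longrightarrow> distr M (count_space UNIV) (X (Inr m)) = measure_pmf (pmf_of_set {1..n})"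
    and "finite K"
    and cover: "\<And>u. (\<And>m. m \<in> J \<Longrightarrow> u m \<in> {1..n}) \<Longrightarrow> \<exists>t\<in>K. \<forall>m\<in>J. u m = v t m"
    and bound: "\<And>N. n \<le> N \<Longrightarrow> (1 / real n) ^ card J * (\<Sum>t\<in>K. prob {\<omega> \<in> space M.
        coalesce (\<lambda>i. X (Inl i) \<omega>) (- int N) ((\<lambda>m. int (v t m)) ` J)}) \<le> B"
    and D: "\<And>\<omega>. \<omega> \<in> D \<Longrightarrow> \<omega> \<in> space M \<and>
        (\<exists>lo. coalesce (\<lambda>i. X (Inl i) \<omega>) lo ((\<lambda>m. int (X (Inr m) \<omega>)) ` J))"
  shows "prob D \<le> B"
proof -
  let ?R = "\<lambda>\<omega> i. X (Inl i) \<omega>" and ?S = "\<lambda>t. (\<lambda>m. int (v t m)) ` J"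
  define x where "x t = case_sum (\<lambda>_::int. 0) (v t)" for t
  define G where "G N t = {\<omega> \<in> space M. (\<forall>a\<in>Inr ` J. X a \<omega> = x t a) \<and> coalesce (?R \<omega>) (- int N) (?S t)}" for N t
  have rv: "X (Inr m) \<in> M \<rightarrow>\<^sub>M count_space UNIV" if "m \<in> J" for m
    using indep that by (auto simp: indep_vars_def)
  have G: "G N t \<in> events"
    "prob (G N t) \<le> (1 / real n) ^ card J * prob {\<omega> \<in> space M. coalesce (?R \<omega>) (- int N) (?S t)}" for N t
  proof -
    define hi where "hi = Max (insert 0 (?S t)) + 1"
    have hi: "s < hi" if "s \<in> ?S t" for s
    proof -
      have "s \<le> Max (insert 0 (?S t))" using that \<open>finite J\<close> by (intro Max_ge) auto
      then show ?thesis by (simp add: hi_def)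
    qed
    have loc: "coalesce (\<lambda>i. y (Inl i)) (- int N) (?S t) \<longleftrightarrow> coalesce (\<lambda>i. z (Inl i)) (- int N) (?S t)"
      if "\<And>b. b \<in> Inl ` {- int N..<hi} \<Longrightarrow> y b = z b" for y z :: "int + nat \<Rightarrow> nat"
      by (rule coalesce_local[of _ hi]) (auto intro!: that hi)
    have sub: "Inr ` J \<subseteq> UNIV <+> J" "Inl ` {- int N..<hi} \<subseteq> UNIV <+> J" "Inr ` J \<inter> Inl ` {- int N..<hi} = {}"
      by auto
    note split = prob_values_and_local_event[OF indep _ _ sub(3,1,2), where x = "x t"
        and Q = "\<lambda>y. coalesce (\<lambda>i. y (Inl i)) (- int N) (?S t)", OF _ _ loc]
    have value_eq: "{\<omega> \<in> space M. X (Inr m) \<omega> = k} = X (Inr m) -` {k} \<inter> space M" for m k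
      by auto
    have values_sets: "{\<omega> \<in> space M. \<forall>a\<in>Inr ` J. X a \<omega> = x t a} \<in> events"
    proof (cases "J = {}")
      case False
      have "{\<omega> \<in> space M. \<forall>a\<in>Inr ` J. X a \<omega> = x t a} = (\<Inter>m\<in>J. {\<omega> \<in> space M. X (Inr m) \<omega> = x t (Inr m)})"
        using False by auto
      also have "\<dots> \<in> events"
        unfolding value_eq using False \<open>finite J\<close> rv by (intro sets.finite_INT measurable_sets) auto
      finally show ?thesis .
    qed simp
    have coal_sets: "{\<omega> \<in> space M. coalesce (?R \<omega>) (- int N) (?S t)} \<in> events"
      by (rule sets_local_event[OF indep _ _ sub(3,1,2), where Q = "\<lambda>y. coalesce (\<lambda>i. y (Inl i)) (- int N) (?S t)", OF _ _ loc])
        (auto simp: \<open>finite J\<close>)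
    have "G N t = {\<omega> \<in> space M. \<forall>a\<in>Inr ` J. X a \<omega> = x t a} \<inter> {\<omega> \<in> space M. coalesce (?R \<omega>) (- int N) (?S t)}"
      by (auto simp: G_def)
    then show "G N t \<in> events" using values_sets coal_sets by simp
    have "prob {\<omega> \<in> space M. X (Inr m) \<omega> = k} \<le> 1 / real n" if "m \<in> J" for m k
    proof -
      have "prob {\<omega> \<in> space M. X (Inr m) \<omega> = k} = measure (distr M (count_space UNIV) (X (Inr m))) {k}"
        unfolding value_eq by (rule measure_distr[symmetric, OF rv[OF that]]) simp
      also have "\<dots> = pmf (pmf_of_set {1..n}) k"
        by (simp add: uniform[OF that] pmf.rep_eq)
      also have "\<dots> \<le> 1 / real n" using \<open>1 \<le> n\<close> by (simp add: indicator_def)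
      finally show ?thesis .
    qed
    then have "(\<Prod>a\<in>Inr ` J. prob {\<omega> \<in> space M. X a \<omega> = x t a}) \<le> (\<Prod>a\<in>(Inr ` J :: (int + nat) set). 1 / real n)"
      by (intro prod_mono) auto
    also have "\<dots> = (1 / real n) ^ card J" by (simp add: card_image)
    finally have "(\<Prod>a\<in>Inr ` J. prob {\<omega> \<in> space M. X a \<omega> = x t a})
        * prob {\<omega> \<in> space M. coalesce (?R \<omega>) (- int N) (?S t)}
      \<le> (1 / real n) ^ card J * prob {\<omega> \<in> space M. coalesce (?R \<omega>) (- int N) (?S t)}"
      by (rule mult_right_mono) simp
    then show "prob (G N t) \<le> (1 / real n) ^ card J * prob {\<omega> \<in> space M. coalesce (?R \<omega>) (- int N) (?S t)}"
      unfolding G_def using split \<open>finite J\<close> by simp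
  qed
  define F where "F N = (\<Union>t\<in>K. G N t)" for N
  have F_sets: "range F \<subseteq> events" using G(1) \<open>finite K\<close> by (auto simp: F_def)
  have "incseq F"
    unfolding incseq_def F_def G_def by (fastforce elim: coalesce_antimono)
  have F_le: "prob (F N) \<le> B" if "n \<le> N" for N
  proof -
    have "prob (F N) \<le> (\<Sum>t\<in>K. prob (G N t))"
      unfolding F_def using G(1) \<open>finite K\<close> by (intro finite_measure_subadditive_finite) auto
    also have "\<dots> \<le> (\<Sum>t\<in>K. (1 / real n) ^ card J * prob {\<omega> \<in> space M. coalesce (?R \<omega>) (- int N) (?S t)})"
      by (intro sum_mono G(2))
    also have "\<dots> \<le> B" using bound[OF that] by (simp add: sum_distrib_left)
    finally show ?thesis .
  qed
  have "AE \<omega> in M. \<forall>m\<in>J. X (Inr m) \<omega> \<in> {1..n}"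
  proof (rule AE_finite_allI[OF \<open>finite J\<close>])
    fix m assume m: "m \<in> J"
    have "AE k in distr M (count_space UNIV) (X (Inr m)). k \<in> {1..n}"
      unfolding uniform[OF m] using \<open>1 \<le> n\<close> by (simp add: AE_measure_pmf_iff)
    then show "AE \<omega> in M. X (Inr m) \<omega> \<in> {1..n}" by (rule AE_distrD[OF rv[OF m]])
  qed
  then have "AE \<omega> in M. \<omega> \<in> D \<longrightarrow> \<omega> \<in> (\<Union>N. F N)"
  proof eventually_elim
    case (elim \<omega>)
    show ?case
    proof
      assume "\<omega> \<in> D"
      then obtain lo where lo: "\<omega> \<in> space M" "coalesce (?R \<omega>) lo ((\<lambda>m. int (X (Inr m) \<omega>)) ` J)"
        using D by blast
      obtain t where t: "t \<in> K" "\<And>m. m \<in> J \<Longrightarrow> X (Inr m) \<omega> = v t m"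
        using cover[of "\<lambda>m. X (Inr m) \<omega>"] elim by blast
      have "coalesce (?R \<omega>) (- int (nat \<bar>lo\<bar>)) (?S t)"
        using coalesce_antimono[OF lo(2), of "- int (nat \<bar>lo\<bar>)"] t(2) by (simp cong: image_cong)
      then have "\<omega> \<in> G (nat \<bar>lo\<bar>) t" using lo(1) t(2) by (auto simp: G_def x_def)
      then show "\<omega> \<in> (\<Union>N. F N)" using t(1) by (auto simp: F_def)
    qed
  qed
  then have "prob D \<le> prob (\<Union>N. F N)"
    using F_sets by (intro finite_measure_mono_AE) auto
  also have "\<dots> \<le> B"
    by (rule LIMSEQ_le_const2[OF finite_Lim_measure_incseq[OF F_sets \<open>incseq F\<close>]]) (use F_le in blast)
  finally show ?thesis .
qed

text \<open>
  Summing over the positions of \<open>k + 1\<close> sampled vertices gives a factor \<open>n\<close> for the first and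
  \<open>c * n powr (1 - u)\<close> for each of the others; dividing by \<open>n ^ Suc k\<close> leaves \<open>n powr (- u)\<close> for each
  of the \<open>k\<close> others.
\<close>

lemma bigo_power_of_average:
  fixes f :: "nat \<Rightarrow> real" and A c u e :: real and k :: nat
  assumes nonneg: "\<And>n. 0 \<le> f n"
    and le: "\<And>n. 1 \<le> n \<Longrightarrow> f n \<le> (1 / real n) ^ Suc k * (A * real n * (c * real n powr (1 - u)) ^ k)"
    and e: "- (u * real k) \<le> e"
  shows "f \<in> O(\<lambda>n. real n powr e)"
proof (rule bigoI)
  show "eventually (\<lambda>n. norm (f n) \<le> \<bar>A * c ^ k\<bar> * norm (real n powr e)) sequentially"
    using eventually_ge_at_top[of 1]
  proof eventually_elim
    case (elim n)
    have "real n powr (1 - u) / real n = real n powr (- u)"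
      using elim by (simp add: powr_diff powr_minus_divide)
    then have "(1 / real n) ^ Suc k * (A * real n * (c * real n powr (1 - u)) ^ k)
        = A * c ^ k * (real n powr (- u)) ^ k"
      using elim by (simp add: power_mult_distrib power_divide flip: \<open>_ = real n powr (- u)\<close>)
    also have "(real n powr (- u)) ^ k = real n powr (- (u * real k))"
      using elim by (simp add: powr_powr flip: powr_realpow)
    also have "A * c ^ k * \<dots> \<le> \<bar>A * c ^ k\<bar> * real n powr e"
      using elim e by (intro mult_mono powr_mono) auto
    finally show ?case using le[OF elim] nonneg[of n] by simp
  qed
qed

theorem proposition2p3:
  fixes \<alpha> :: real
    and L :: "real \<Rightarrow> real"
    and \<mu> :: "nat pmf"
    and M :: "'a measure"
    and R :: "int \<Rightarrow> 'a \<Rightarrow> nat"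
    and V\<^sub>I V\<^sub>J V\<^sub>K V\<^sub>L :: "nat \<Rightarrow> 'a \<Rightarrow> nat"
  assumes alpha: "0 < \<alpha>" "\<alpha> < 1/2"
    and L_pos: "\<And>x. 0 < L x"
    and L_sv: "slowly_varying L"
    and mu_supp: "0 \<notin> set_pmf \<mu>"
    and mu_tail: "(\<lambda>n. measure_pmf.prob \<mu> {n..}) \<sim>[at_top] (\<lambda>n. real n powr (-\<alpha>) * L (real n))"
    and mu_gcd: "Gcd {n. 0 < pmf \<mu> n} = 1"
    and renewal: "renewal_weight \<mu> \<sim>[at_top]
        (\<lambda>n. 1 / (Gamma \<alpha> * Gamma (1 - \<alpha>)) * (real n powr (\<alpha> - 1) / L (real n)))"
    and M: "prob_space M"
    and R_distr: "\<And>i. distr M (count_space UNIV) (R i) = measure_pmf \<mu>"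
    and V_distr: "\<And>n X. n \<ge> 1 \<Longrightarrow> X \<in> {V\<^sub>I, V\<^sub>J, V\<^sub>K, V\<^sub>L} \<Longrightarrow>
        distr M (count_space UNIV) (X n) = measure_pmf (pmf_of_set {1..n})"
    \<comment> \<open>for each \<open>n\<close>, all the \<open>R i\<close> and the four uniform variables are jointly independent\<close>
    and indep: "\<And>n. n \<ge> 1 \<Longrightarrow> prob_space.indep_vars M (\<lambda>_. count_space UNIV)
        (case_sum R (\<lambda>m. [V\<^sub>I n, V\<^sub>J n, V\<^sub>K n, V\<^sub>L n] ! m)) (UNIV <+> {..<4})"
  shows "\<forall>\<delta>>0.
      (\<lambda>n. measure M {\<omega> \<in> space M.
          same_component (\<lambda>i. R i \<omega>) (int (V\<^sub>I n \<omega>)) (int (V\<^sub>J n \<omega>)) \<and>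
          same_component (\<lambda>i. R i \<omega>) (int (V\<^sub>J n \<omega>)) (int (V\<^sub>K n \<omega>))})
        \<in> O(\<lambda>n. real n powr (4 * \<alpha> - 2 + \<delta>)) \<and>
      (\<lambda>n. measure M {\<omega> \<in> space M.
          same_component (\<lambda>i. R i \<omega>) (int (V\<^sub>I n \<omega>)) (int (V\<^sub>J n \<omega>)) \<and>
          same_component (\<lambda>i. R i \<omega>) (int (V\<^sub>J n \<omega>)) (int (V\<^sub>K n \<omega>)) \<and>
          same_component (\<lambda>i. R i \<omega>) (int (V\<^sub>K n \<omega>)) (int (V\<^sub>L n \<omega>))})
        \<in> O(\<lambda>n. real n powr (6 * \<alpha> - 3 + \<delta>))"
proof (intro allI impI)
  fix \<delta> :: real assume "0 < \<delta>"
  \<comment> \<open>The first bound on \<open>\<epsilon>\<close> keeps the loss in the exponents below \<open>\<delta>\<close>, the second keeps \<open>\<beta>\<close> above \<open>1 / 2\<close>.\<close>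
  define \<epsilon> where "\<epsilon> = min (\<delta> / 6) ((1 / 2 - \<alpha>) / 2)"
  define \<beta> where "\<beta> = 1 - \<alpha> - \<epsilon>"
  have \<epsilon>: "0 < \<epsilon>" "\<alpha> + \<epsilon> < 1 / 2" "6 * \<epsilon> \<le> \<delta>"
    using \<open>0 < \<delta>\<close> alpha by (auto simp: \<epsilon>_def min_def field_simps)
  have \<beta>: "1 / 2 < \<beta>" "\<beta> < 1" using \<epsilon> alpha by (auto simp: \<beta>_def)
  obtain C where C: "\<And>n. renewal_weight \<mu> n \<le> C * (1 + real n) powr (- \<beta>)"
    using renewal_weight_le_powr[OF \<epsilon>(1) alpha(1) _ L_pos L_sv mu_tail renewal] \<epsilon> by (auto simp: \<beta>_def)
  obtain K where K: "\<And>W a b. finite W \<Longrightarrow>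
      (\<Sum>m\<in>W. decay \<beta> (a - m) * decay \<beta> (b - m)) \<le> K * decay (2 * \<beta> - 1) (a - b)"
    using decay_convolution[OF \<beta>] by metis
  have C_nonneg: "0 \<le> C" using C[of 0] by (simp add: renewal_weight_0)
  have "hitting_weight \<mu> d \<le> C * decay \<beta> d" for d
  proof (cases "d < 0")
    case True
    then show ?thesis using C_nonneg less_imp_le[OF decay_pos] by (simp add: hitting_weight_def)
  next
    case False
    then show ?thesis using C[of "nat d"] by (simp add: hitting_weight_def decay_def)
  qed
  then have dom: "dominated_kernel (hitting_weight \<mu>) {lo..hi} \<beta> C K" for lo hi
    by (intro dominated_kernel.intro hitting_weight_nonneg \<beta> K) auto
  interpret prob_space M by (rule M)
  define X where "X n = case_sum R (\<lambda>m. [V\<^sub>I n, V\<^sub>J n, V\<^sub>K n, V\<^sub>L n] ! m)" for n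
  have X: "indep_vars (\<lambda>_. count_space UNIV) (X n) (UNIV <+> {..<4})" if "1 \<le> n" for n
    unfolding X_def by (rule indep[OF that])
  have "indep_vars (\<lambda>_. count_space UNIV) (\<lambda>i. X 1 (Inl i)) (UNIV :: int set)"
    by (rule indep_vars_reindex[OF _ indep_vars_subset[OF X[of 1]]]) auto
  then interpret iid_jumps M \<mu> R
    by (intro iid_jumps.intro iid_jumps_axioms.intro M R_distr mu_supp) (simp add: X_def)
  have uniform: "distr M (count_space UNIV) (X n (Inr m)) = measure_pmf (pmf_of_set {1..n})"
    if "1 \<le> n" "m < 4" for n m
  proof -
    have "m \<in> {0, 1, 2, 3}" using that(2) by auto
    then show ?thesis
      using V_distr[OF that(1), of V\<^sub>I] V_distr[OF that(1), of V\<^sub>J]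
        V_distr[OF that(1), of V\<^sub>K] V_distr[OF that(1), of V\<^sub>L] by (auto simp: X_def)
  qed
  define c where "c = C\<^sup>2 * K * (1 + 2 / (1 - (2 * \<beta> - 1)))"
  define p where "p n = c * real n powr (1 - (2 * \<beta> - 1))" for n
  have partners: "dominated_kernel.partners \<beta> C K n = p n" for n
    by (simp add: dominated_kernel.partners_def[OF dom] dominated_kernel.spread_def[OF dom] p_def c_def)
  let ?I = "\<lambda>n. int ` {1..n}"
  let ?E3 = "\<lambda>n. {\<omega> \<in> space M.
      same_component (\<lambda>i. R i \<omega>) (int (V\<^sub>I n \<omega>)) (int (V\<^sub>J n \<omega>)) \<and>
      same_component (\<lambda>i. R i \<omega>) (int (V\<^sub>J n \<omega>)) (int (V\<^sub>K n \<omega>))}"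
  let ?E4 = "\<lambda>n. {\<omega> \<in> space M.
      same_component (\<lambda>i. R i \<omega>) (int (V\<^sub>I n \<omega>)) (int (V\<^sub>J n \<omega>)) \<and>
      same_component (\<lambda>i. R i \<omega>) (int (V\<^sub>J n \<omega>)) (int (V\<^sub>K n \<omega>)) \<and>
      same_component (\<lambda>i. R i \<omega>) (int (V\<^sub>K n \<omega>)) (int (V\<^sub>L n \<omega>))}"
  have E3: "prob (?E3 n) \<le> (1 / real n) ^ 3 * (6 * real n * (p n)\<^sup>2)" if n: "1 \<le> n" for n
  proof (rule prob_sampled_coalescence_le[where X = "X n" and J = "{..<3}" and n = n
        and K = "{1..n} \<times> {1..n} \<times> {1..n}" and v = "\<lambda>(i, j, k) m. [i, j, k] ! m"])
    show "indep_vars (\<lambda>_. count_space UNIV) (X n) (UNIV <+> {..<3})"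
      by (rule indep_vars_subset[OF X[OF n]]) auto
    show "\<exists>t\<in>{1..n} \<times> {1..n} \<times> {1..n}. \<forall>m\<in>{..<3}. u m = (case t of (i, j, k) \<Rightarrow> (\<lambda>m. [i, j, k] ! m)) m"
      if "\<And>m. m \<in> {..<3} \<Longrightarrow> u m \<in> {1..n}" for u
      using that by (intro bexI[of _ "(u 0, u 1, u 2)"]) (auto simp: less_Suc_eq numeral_3_eq_3 numeral_2_eq_2)
    show "(1 / real n) ^ card {..<3::nat} * (\<Sum>t\<in>{1..n} \<times> {1..n} \<times> {1..n}. prob {\<omega> \<in> space M.
        coalesce (\<lambda>i. X n (Inl i) \<omega>) (- int N) ((\<lambda>m. int ((case t of (i, j, k) \<Rightarrow> (\<lambda>m. [i, j, k] ! m)) m)) ` {..<3})})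
      \<le> (1 / real n) ^ 3 * (6 * real n * (p n)\<^sup>2)" (is "_ * ?S \<le> _") if N: "n \<le> N" for N
    proof -
      have "?S = (\<Sum>(i, j, k)\<in>{1..n} \<times> {1..n} \<times> {1..n}. prob (coalescence (- int N) {int i, int j, int k}))"
        by (intro sum.cong refl) (auto simp: coalescence_def X_def numeral_3_eq_3 lessThan_Suc insert_commute)
      also have "\<dots> \<le> (\<Sum>(i, j, k)\<in>{1..n} \<times> {1..n} \<times> {1..n}.
          triple_weight (hitting_weight \<mu>) {- int N..int N} (int i) (int j) (int k))"
        using N by (intro sum_mono) (auto intro!: prob_coalescence_triple)
      also have "\<dots> = (\<Sum>i\<in>?I n. \<Sum>j\<in>?I n. \<Sum>k\<in>?I n. triple_weight (hitting_weight \<mu>) {- int N..int N} i j k)"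
        by (simp add: sum.cartesian_product[symmetric] sum.reindex)
      also have "\<dots> \<le> (\<Sum>i\<in>?I n. 6 * (p n)\<^sup>2)"
        using dominated_kernel.sum_triple_weight_le[OF dom, of "?I n" "- int N" "int N"]
        by (intro sum_mono) (simp add: partners card_image)
      finally have "?S \<le> 6 * real n * (p n)\<^sup>2" by (simp add: card_image)
      then show ?thesis by (simp add: mult_left_mono)
    qed
    fix \<omega> assume "\<omega> \<in> ?E3 n"
    then show "\<omega> \<in> space M \<and> (\<exists>lo. coalesce (\<lambda>i. X n (Inl i) \<omega>) lo ((\<lambda>m. int (X n (Inr m) \<omega>)) ` {..<3}))"
      by (auto intro!: same_component_imp_coalesce[where a = "int (V\<^sub>J n \<omega>)"]
          simp: X_def numeral_3_eq_3 lessThan_Suc same_component_refl intro: same_component_sym)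
  qed (use n uniform in auto)
  have E4: "prob (?E4 n) \<le> (1 / real n) ^ 4 * (36 * real n * p n ^ 3)" if n: "1 \<le> n" for n
  proof (rule prob_sampled_coalescence_le[where X = "X n" and J = "{..<4}" and n = n
        and K = "{1..n} \<times> {1..n} \<times> {1..n} \<times> {1..n}" and v = "\<lambda>(i, j, k, l) m. [i, j, k, l] ! m"])
    show "indep_vars (\<lambda>_. count_space UNIV) (X n) (UNIV <+> {..<4})"
      by (rule indep_vars_subset[OF X[OF n]]) auto
    show "\<exists>t\<in>{1..n} \<times> {1..n} \<times> {1..n} \<times> {1..n}. \<forall>m\<in>{..<4}. u m = (case t of (i, j, k, l) \<Rightarrow> (\<lambda>m. [i, j, k, l] ! m)) m"
      if "\<And>m. m \<in> {..<4} \<Longrightarrow> u m \<in> {1..n}" for u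
      using that by (intro bexI[of _ "(u 0, u 1, u 2, u 3)"]) (auto simp: less_Suc_eq eval_nat_numeral)
    show "(1 / real n) ^ card {..<4::nat} * (\<Sum>t\<in>{1..n} \<times> {1..n} \<times> {1..n} \<times> {1..n}. prob {\<omega> \<in> space M.
        coalesce (\<lambda>i. X n (Inl i) \<omega>) (- int N) ((\<lambda>m. int ((case t of (i, j, k, l) \<Rightarrow> (\<lambda>m. [i, j, k, l] ! m)) m)) ` {..<4})})
      \<le> (1 / real n) ^ 4 * (36 * real n * p n ^ 3)" (is "_ * ?S \<le> _") if N: "n \<le> N" for N
    proof -
      have "?S = (\<Sum>(i, j, k, l)\<in>{1..n} \<times> {1..n} \<times> {1..n} \<times> {1..n}. prob (coalescence (- int N) {int i, int j, int k, int l}))"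
        by (intro sum.cong refl) (auto simp: coalescence_def X_def lessThan_nat_numeral lessThan_Suc insert_commute)
      also have "\<dots> \<le> (\<Sum>(i, j, k, l)\<in>{1..n} \<times> {1..n} \<times> {1..n} \<times> {1..n}.
          quadruple_weight (hitting_weight \<mu>) {- int N..int N} (int i) (int j) (int k) (int l))"
        using N by (intro sum_mono) (auto intro!: prob_coalescence_quadruple)
      also have "\<dots> = (\<Sum>i\<in>?I n. \<Sum>j\<in>?I n. \<Sum>k\<in>?I n. \<Sum>l\<in>?I n. quadruple_weight (hitting_weight \<mu>) {- int N..int N} i j k l)"
        by (simp add: sum.cartesian_product[symmetric] sum.reindex)
      also have "\<dots> \<le> 36 * real n * p n ^ 3"
        using dominated_kernel.sum_quadruple_weight_le[OF dom, of "?I n" "- int N" "int N"]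
        by (simp add: partners card_image)
      finally have "?S \<le> 36 * real n * p n ^ 3" .
      then show ?thesis by (simp add: mult_left_mono)
    qed
    fix \<omega> assume "\<omega> \<in> ?E4 n"
    moreover from this have "same_component (\<lambda>i. R i \<omega>) (int (V\<^sub>L n \<omega>)) (int (V\<^sub>J n \<omega>))"
      by (blast intro: same_component_sym same_component_trans)
    ultimately show "\<omega> \<in> space M \<and> (\<exists>lo. coalesce (\<lambda>i. X n (Inl i) \<omega>) lo ((\<lambda>m. int (X n (Inr m) \<omega>)) ` {..<4}))"
      by (auto intro!: same_component_imp_coalesce[where a = "int (V\<^sub>J n \<omega>)"]
          simp: X_def lessThan_nat_numeral lessThan_Suc same_component_refl intro: same_component_sym)
  qed (use n uniform in auto)
  have "(\<lambda>n. prob (?E3 n)) \<in> O(\<lambda>n. real n powr (4 * \<alpha> - 2 + \<delta>))"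
    using E3 \<epsilon> by (intro bigo_power_of_average[where k = 2 and A = 6 and c = c and u = "2 * \<beta> - 1"])
      (auto simp: p_def \<beta>_def eval_nat_numeral)
  moreover have "(\<lambda>n. prob (?E4 n)) \<in> O(\<lambda>n. real n powr (6 * \<alpha> - 3 + \<delta>))"
    using E4 \<epsilon> by (intro bigo_power_of_average[where k = 3 and A = 36 and c = c and u = "2 * \<beta> - 1"])
      (auto simp: p_def \<beta>_def eval_nat_numeral)
  ultimately show "(\<lambda>n. measure M (?E3 n)) \<in> O(\<lambda>n. real n powr (4 * \<alpha> - 2 + \<delta>)) \<and>
      (\<lambda>n. measure M (?E4 n)) \<in> O(\<lambda>n. real n powr (6 * \<alpha> - 3 + \<delta>))" ..
qed

end
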